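(* Any two solutions $\boldsymbol\lambda$ and $\widehat{\boldsymbol\lambda}$ (whenever these exist) to the problem of minimizing $G_{\kappa,\mathbf f}(\boldsymbol\mu)$ over $\boldsymbol\mu\in\mathcal E^{\boldsymbol\sigma}_{\kappa,\mathbf f}(\mathbf A,\mathbf a,\mathbf g)$ are equivalent in $\mathcal E^+_\kappa(\mathbf A)$, i.e. $\|\boldsymbol\lambda-\widehat{\boldsymbol\lambda}\|_{\mathcal E^+_\kappa(\mathbf A)}=0$.
   Context: **Measures and kernels.** $X$ is a locally compact Hausdorff space, $\mathfrak M(X)$ the space of real-valued (signed) Radon measures on $X$, $\mathfrak M^+(X)$ its positive elements. $\nu\in\mathfrak M^+(X)$ is carried by $Q\subset X$ if $X\setminus Q$ is locally $\nu$-negligible (equivalently, $Q$ is $\nu$-measurable and $\nu=\nu|_Q$); $\mathfrak M^+(Q)$ is the set of such $\nu$. $\langle\psi,\nu\rangle:=\int\psi\,d\nu$. A kernel is a symmetric l.s.c. function $\kappa:X\times X\to(-\infty,\infty]$, required to be nonnegative unless $X$ is compact. Write $\kappa(\mu,\nu):=\int\kappa\,d(\mu\otimes\nu)$. The kernel is assumed positive definite: $\kappa(\nu,\nu)\geqslant0$ for every $\nu\in\mathfrak M(X)$ for which it is defined (i.e. $\kappa(\nu^+,\nu^+)+\kappa(\nu^-,\nu^-)$ or $\kappa(\nu^+,\nu^-)$ is finite). $\mathcal E_\kappa(X):=\{\nu\in\mathfrak M(X):\kappa(\nu,\nu)\text{ finite}\}$ is a pre-Hilbert space with inner product $\kappa(\mu,\nu)$.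 **Condenser.** $I=I^+\cup I^-$ is a countable index set, $I^+\cap I^-=\varnothing$ ($I^-$ may be empty), $s_i:=+1$ for $i\in I^+$, $s_i:=-1$ for $i\in I^-$. $\mathbf A=(A_i)_{i\in I}$ is a generalized condenser: nonempty Borel sets $A_i\subset X$ such that every compact set meets at most finitely many $A_i$, and $A_i\cap A_j=\varnothing$ for $i\in I^+$, $j\in I^-$. **Vector measures.** $\mathfrak M^+(\mathbf A):=\prod_{i\in I}\mathfrak M^+(A_i)$. A numerical series over $I$ is finite iff it has finite terms and converges absolutely. The energy of $\boldsymbol\mu=(\mu^i)_{i\in I}\in\mathfrak M^+(\mathbf A)$ is $\kappa(\boldsymbol\mu,\boldsymbol\mu):=\sum_{i,j\in I}s_is_j\kappa(\mu^i,\mu^j)$; $\mathcal E^+_\kappa(\mathbf A)$ is the set of $\boldsymbol\mu$ with finite energy. It is a semimetric space with $\|\boldsymbol\mu_1-\boldsymbol\mu_2\|_{\mathcal E^+_\kappa(\mathbf A)}:=\bigl[\sum_{i,j\in I}s_is_j\kappa(\mu_1^i-\mu_2^i,\mu_1^j-\mu_2^j)\bigr]^{1/2}$. **The problem.** Given: $\mathbf a=(a_i)_{i\in I}$, $a_i>0$; $\mathbf g=(g_i)_{i\in I}$ with continuous $g_i:X\to(0,\infty)$; an external field $\mathbf f=(f_i)_{i\in I}$, where each $f_i:X\to[-\infty,\infty]$ is $\mu$-measurable for every $\mu\in\mathfrak M^+(X)$; $I_0\subset I$ (possibly empty); constraints $\xi^i\in\mathfrak M^+(A_i)$, $i\in I_0$,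 with $\langle g_i,\xi^i\rangle>a_i$. Put $\sigma^i=\xi^i$ for $i\in I_0$, $\sigma^i=\infty$ (no constraint) for $i\in I\setminus I_0$, $\boldsymbol\sigma=(\sigma^i)_{i\in I}$. $\mathcal E^{\boldsymbol\sigma}_{\kappa,\mathbf f}(\mathbf A,\mathbf a,\mathbf g)$ is the set of $\boldsymbol\mu\in\mathcal E_\kappa^+(\mathbf A)$ with $\langle g_i,\mu^i\rangle=a_i$ for all $i\in I$, $\mu^i\leqslant\xi^i$ for all $i\in I_0$, and $\langle\mathbf f,\boldsymbol\mu\rangle:=\sum_{i\in I}\langle f_i,\mu^i\rangle$ finite (every $f_i$ being $\mu^i$-integrable). It is assumed nonempty. $G_{\kappa,\mathbf f}(\boldsymbol\mu):=\kappa(\boldsymbol\mu,\boldsymbol\mu)+2\langle\mathbf f,\boldsymbol\mu\rangle$. A solution is an element of $\mathcal E^{\boldsymbol\sigma}_{\kappa,\mathbf f}(\mathbf A,\mathbf a,\mathbf g)$ at which the infimum of $G_{\kappa,\mathbf f}$ over this class is attained. *)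

theory Defs
  imports "HOL-Analysis.Analysis"
begin

section \<open>Radon measures\<close>

text \<open>
  A positive Radon measure on a locally compact Hausdorff space is represented by the Borel
  measure that is finite on compact sets and inner regular by compact sets on \<^emph>\<open>all\<close> Borel sets;
  this gives a bijection with the positive linear functionals on $C_c(X)$, also when $X$ is not
  $\sigma$-compact.  In this representation the vague order is the setwise order of measures,
  and the integral is Bourbaki's essential integral.  It agrees with his upper integral on
  nonnegative l.s.c. functions and for every measure having a finite integral against a
  strictly positive continuous function.
\<close>

definition radon :: "'a::topological_space measure \<Rightarrow> bool" where
  "radon \<mu> \<longleftrightarrow> sets \<mu> = sets borel
     \<and> (\<forall>K. compact K \<longrightarrow> emeasure \<mu> K < \<infinity>)
     \<and> (\<forall>B\<in>sets borel. emeasure \<mu> B = (SUP K\<in>{K. compact K \<and> K \<subseteq> B}. emeasure \<mu> K))"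

text \<open>The library order on measures is lexicographic in space and sigma-algebra; this is the
  plain setwise order.\<close>

definition measure_le :: "'a::topological_space measure \<Rightarrow> 'a measure \<Rightarrow> bool" where
  "measure_le \<mu> \<nu> \<longleftrightarrow> (\<forall>B\<in>sets borel. emeasure \<mu> B \<le> emeasure \<nu> B)"

definition locally_negligible :: "'a::topological_space measure \<Rightarrow> 'a set \<Rightarrow> bool" where
  "locally_negligible \<nu> N \<longleftrightarrow> (\<forall>K. compact K \<longrightarrow> N \<inter> K \<in> null_sets (completion \<nu>))"

definition Mplus :: "'a::topological_space set \<Rightarrow> 'a measure set" where
  "Mplus Q = {\<nu>. radon \<nu> \<and> locally_negligible \<nu> (- Q)}"

text \<open>\<open>\<mu>\<close>-measurability in the sense of Radon measures is a local notion: it is tested on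
  compact sets, with respect to the completed measure.\<close>

definition radon_measurable :: "'a::topological_space measure \<Rightarrow> ('a \<Rightarrow> ereal) \<Rightarrow> bool" where
  "radon_measurable \<mu> f \<longleftrightarrow>
     (\<forall>K. compact K \<longrightarrow> f \<in> borel_measurable (restrict_space (completion \<mu>) K))"

text \<open>Since \<open>\<infinity> - \<infinity> = \<infinity>\<close> in \<open>ereal\<close>, the value below is finite iff the integrals of the
  positive part and of the negative part are both finite.\<close>

definition ereal_integral :: "'b measure \<Rightarrow> ('b \<Rightarrow> ereal) \<Rightarrow> ereal" where
  "ereal_integral M f =
     enn2ereal (\<integral>\<^sup>+ x. e2ennreal (f x) \<partial>M) - enn2ereal (\<integral>\<^sup>+ x. e2ennreal (- f x) \<partial>M)"

definition pairing :: "('a \<Rightarrow> ereal) \<Rightarrow> 'a measure \<Rightarrow> ereal" where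
  "pairing \<psi> \<nu> = ereal_integral (completion \<nu>) \<psi>"

definition radon_integrable :: "'a measure \<Rightarrow> ('a \<Rightarrow> ereal) \<Rightarrow> bool" where
  "radon_integrable \<nu> \<psi> \<longleftrightarrow>
     \<psi> \<in> borel_measurable (completion \<nu>) \<and> \<bar>pairing \<psi> \<nu>\<bar> \<noteq> \<infinity>"

text \<open>The Radon product lives on the Borel sets of the product space.  Without second
  countability these need not be contained in the product of the Borel sigma-algebras, so the
  library product measure would not do: an l.s.c. kernel need not be measurable for it.\<close>

definition radon_prod ::
    "'a::topological_space measure \<Rightarrow> 'b::topological_space measure \<Rightarrow> ('a \<times> 'b) measure" where
  "radon_prod \<mu> \<nu> = (THE \<rho>. radon \<rho> \<and>
     (\<forall>K L. compact K \<longrightarrow> compact L \<longrightarrow> emeasure \<rho> (K \<times> L) = emeasure \<mu> K * emeasure \<nu> L))"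

text \<open>A signed Radon measure \<open>\<nu>\<close> is represented by the pair \<open>(\<nu>\<^sup>+, \<nu>\<^sup>-)\<close> of its Jordan
  components, i.e. positive Radon measures with lattice infimum 0.  (Both may have infinite total
  mass, so \<open>\<nu>\<close> need not be a set function on all Borel sets.)\<close>

type_synonym 'a smeasure = "'a measure \<times> 'a measure"

definition signed_radon :: "'a::topological_space smeasure \<Rightarrow> bool" where
  "signed_radon \<nu> \<longleftrightarrow> radon (fst \<nu>) \<and> radon (snd \<nu>) \<and>
     (\<forall>\<rho>. radon \<rho> \<longrightarrow> measure_le \<rho> (fst \<nu>) \<longrightarrow> measure_le \<rho> (snd \<nu>) \<longrightarrow> emeasure \<rho> UNIV = 0)"

text \<open>The signed measure \<open>\<mu>\<^sub>1 - \<mu>\<^sub>2\<close> for positive \<open>\<mu>\<^sub>1\<close>, \<open>\<mu>\<^sub>2\<close>: the Jordan pair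
  with \<open>\<mu>\<^sub>1 + \<nu>\<^sup>- = \<mu>\<^sub>2 + \<nu>\<^sup>+\<close>.\<close>

definition radon_diff :: "'a::topological_space measure \<Rightarrow> 'a measure \<Rightarrow> 'a smeasure" where
  "radon_diff \<mu>\<^sub>1 \<mu>\<^sub>2 = (THE \<nu>. signed_radon \<nu> \<and>
     (\<forall>B\<in>sets borel. emeasure \<mu>\<^sub>1 B + emeasure (snd \<nu>) B = emeasure \<mu>\<^sub>2 B + emeasure (fst \<nu>) B))"

section \<open>Kernels and energies\<close>

definition lower_semicontinuous :: "('b::topological_space \<Rightarrow> ereal) \<Rightarrow> bool" where
  "lower_semicontinuous h \<longleftrightarrow> (\<forall>c. open {z. c < h z})"

definition symmetric_lsc_kernel :: "('a::topological_space \<times> 'a \<Rightarrow> ereal) \<Rightarrow> bool" where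
  "symmetric_lsc_kernel \<kappa> \<longleftrightarrow> (\<forall>x y. \<kappa> (x, y) = \<kappa> (y, x)) \<and> lower_semicontinuous \<kappa> \<and> (\<forall>z. \<kappa> z \<noteq> - \<infinity>)
     \<and> (\<not> compact (UNIV :: 'a set) \<longrightarrow> (\<forall>z. 0 \<le> \<kappa> z))"

definition mutual_energy ::
    "('a::topological_space \<times> 'a \<Rightarrow> ereal) \<Rightarrow> 'a measure \<Rightarrow> 'a measure \<Rightarrow> ereal" where
  "mutual_energy \<kappa> \<mu> \<nu> = ereal_integral (radon_prod \<mu> \<nu>) \<kappa>"

text \<open>For a kernel all four terms are \<open>> -\<infinity>\<close>, hence the value is finite iff all of them are.\<close>

definition signed_mutual_energy ::
    "('a::topological_space \<times> 'a \<Rightarrow> ereal) \<Rightarrow> 'a smeasure \<Rightarrow> 'a smeasure \<Rightarrow> ereal" where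
  "signed_mutual_energy \<kappa> \<mu> \<nu> =
     (mutual_energy \<kappa> (fst \<mu>) (fst \<nu>) + mutual_energy \<kappa> (snd \<mu>) (snd \<nu>))
     - (mutual_energy \<kappa> (fst \<mu>) (snd \<nu>) + mutual_energy \<kappa> (snd \<mu>) (fst \<nu>))"

definition energy_defined ::
    "('a::topological_space \<times> 'a \<Rightarrow> ereal) \<Rightarrow> 'a smeasure \<Rightarrow> bool" where
  "energy_defined \<kappa> \<nu> \<longleftrightarrow>
     \<bar>mutual_energy \<kappa> (fst \<nu>) (fst \<nu>) + mutual_energy \<kappa> (snd \<nu>) (snd \<nu>)\<bar> \<noteq> \<infinity>
     \<or> \<bar>mutual_energy \<kappa> (fst \<nu>) (snd \<nu>)\<bar> \<noteq> \<infinity>"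

definition positive_definite :: "('a::topological_space \<times> 'a \<Rightarrow> ereal) \<Rightarrow> bool" where
  "positive_definite \<kappa> \<longleftrightarrow>
     (\<forall>\<nu>. signed_radon \<nu> \<longrightarrow> energy_defined \<kappa> \<nu> \<longrightarrow> 0 \<le> signed_mutual_energy \<kappa> \<nu> \<nu>)"

section \<open>Condensers and vector measures\<close>

definition series_finite :: "('j \<Rightarrow> ereal) \<Rightarrow> 'j set \<Rightarrow> bool" where
  "series_finite u J \<longleftrightarrow>
     (\<forall>j\<in>J. \<bar>u j\<bar> \<noteq> \<infinity>) \<and> (\<lambda>j. \<bar>real_of_ereal (u j)\<bar>) summable_on J"

definition series_sum :: "('j \<Rightarrow> ereal) \<Rightarrow> 'j set \<Rightarrow> real" where
  "series_sum u J = (\<Sum>\<^sub>\<infinity>j\<in>J. real_of_ereal (u j))"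

text \<open>The index set is \<open>I\<^sup>+ \<union> I\<^sup>-\<close>; vector measures are functions on the index type of which
  only the components with index in \<open>I\<^sup>+ \<union> I\<^sup>-\<close> matter.\<close>

definition generalized_condenser ::
    "'i set \<Rightarrow> 'i set \<Rightarrow> ('i \<Rightarrow> 'a::topological_space set) \<Rightarrow> bool" where
  "generalized_condenser Ipos Ineg A \<longleftrightarrow>
     countable (Ipos \<union> Ineg) \<and> Ipos \<inter> Ineg = {}
     \<and> (\<forall>i\<in>Ipos \<union> Ineg. A i \<noteq> {} \<and> A i \<in> sets borel)
     \<and> (\<forall>K. compact K \<longrightarrow> finite {i\<in>Ipos \<union> Ineg. K \<inter> A i \<noteq> {}})
     \<and> (\<forall>i\<in>Ipos. \<forall>j\<in>Ineg. A i \<inter> A j = {})"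

definition plate_sign :: "'i set \<Rightarrow> 'i \<Rightarrow> real" where
  "plate_sign Ipos i = (if i \<in> Ipos then 1 else - 1)"

definition energy_terms ::
    "('a::topological_space \<times> 'a \<Rightarrow> ereal) \<Rightarrow> 'i set \<Rightarrow> ('i \<Rightarrow> 'a measure) \<Rightarrow> 'i \<times> 'i \<Rightarrow> ereal" where
  "energy_terms \<kappa> Ipos \<mu> =
     (\<lambda>(i, j). ereal (plate_sign Ipos i * plate_sign Ipos j) * mutual_energy \<kappa> (\<mu> i) (\<mu> j))"

definition vector_energy ::
    "('a::topological_space \<times> 'a \<Rightarrow> ereal) \<Rightarrow> 'i set \<Rightarrow> 'i set \<Rightarrow> ('i \<Rightarrow> 'a measure) \<Rightarrow> real" where
  "vector_energy \<kappa> Ipos Ineg \<mu> = series_sum (energy_terms \<kappa> Ipos \<mu>) ((Ipos \<union> Ineg) \<times> (Ipos \<union> Ineg))"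

definition finite_energy_vectors ::
    "('a::topological_space \<times> 'a \<Rightarrow> ereal) \<Rightarrow> 'i set \<Rightarrow> 'i set \<Rightarrow> ('i \<Rightarrow> 'a set)
       \<Rightarrow> ('i \<Rightarrow> 'a measure) set" where
  "finite_energy_vectors \<kappa> Ipos Ineg A =
     {\<mu>. (\<forall>i\<in>Ipos \<union> Ineg. \<mu> i \<in> Mplus (A i))
         \<and> series_finite (energy_terms \<kappa> Ipos \<mu>) ((Ipos \<union> Ineg) \<times> (Ipos \<union> Ineg))}"

text \<open>The semimetric takes the value \<open>\<infinity>\<close> where the defining series is not finite, so that the
  distance is never 0 merely because the series is ill-defined.\<close>

definition distance_terms ::
    "('a::topological_space \<times> 'a \<Rightarrow> ereal) \<Rightarrow> 'i set
       \<Rightarrow> ('i \<Rightarrow> 'a measure) \<Rightarrow> ('i \<Rightarrow> 'a measure) \<Rightarrow> 'i \<times> 'i \<Rightarrow> ereal" where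
  "distance_terms \<kappa> Ipos \<mu>\<^sub>1 \<mu>\<^sub>2 =
     (\<lambda>(i, j). ereal (plate_sign Ipos i * plate_sign Ipos j) *
        signed_mutual_energy \<kappa> (radon_diff (\<mu>\<^sub>1 i) (\<mu>\<^sub>2 i)) (radon_diff (\<mu>\<^sub>1 j) (\<mu>\<^sub>2 j)))"

definition energy_distance ::
    "('a::topological_space \<times> 'a \<Rightarrow> ereal) \<Rightarrow> 'i set \<Rightarrow> 'i set
       \<Rightarrow> ('i \<Rightarrow> 'a measure) \<Rightarrow> ('i \<Rightarrow> 'a measure) \<Rightarrow> ereal" where
  "energy_distance \<kappa> Ipos Ineg \<mu>\<^sub>1 \<mu>\<^sub>2 =
     (let u = distance_terms \<kappa> Ipos \<mu>\<^sub>1 \<mu>\<^sub>2; J = (Ipos \<union> Ineg) \<times> (Ipos \<union> Ineg)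
      in if series_finite u J then ereal (sqrt (series_sum u J)) else \<infinity>)"

section \<open>The constrained weighted minimum energy problem\<close>

definition field_terms ::
    "('i \<Rightarrow> 'a \<Rightarrow> ereal) \<Rightarrow> ('i \<Rightarrow> 'a measure) \<Rightarrow> 'i \<Rightarrow> ereal" where
  "field_terms f \<mu> = (\<lambda>i. pairing (f i) (\<mu> i))"

definition gauss_functional ::
    "('a::topological_space \<times> 'a \<Rightarrow> ereal) \<Rightarrow> 'i set \<Rightarrow> 'i set \<Rightarrow> ('i \<Rightarrow> 'a \<Rightarrow> ereal)
       \<Rightarrow> ('i \<Rightarrow> 'a measure) \<Rightarrow> real" where
  "gauss_functional \<kappa> Ipos Ineg f \<mu> =
     vector_energy \<kappa> Ipos Ineg \<mu> + 2 * series_sum (field_terms f \<mu>) (Ipos \<union> Ineg)"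

text \<open>The constraint \<open>\<sigma>\<close> is given by \<open>I\<^sub>0\<close> and \<open>\<xi>\<close>: there is no constraint on the
  components with index outside \<open>I\<^sub>0\<close>.\<close>

definition admissible ::
    "('a::topological_space \<times> 'a \<Rightarrow> ereal) \<Rightarrow> ('i \<Rightarrow> 'a \<Rightarrow> ereal) \<Rightarrow> 'i set \<Rightarrow> 'i set
       \<Rightarrow> ('i \<Rightarrow> 'a set) \<Rightarrow> ('i \<Rightarrow> real) \<Rightarrow> ('i \<Rightarrow> 'a \<Rightarrow> real) \<Rightarrow> 'i set \<Rightarrow> ('i \<Rightarrow> 'a measure)
       \<Rightarrow> ('i \<Rightarrow> 'a measure) set" where
  "admissible \<kappa> f Ipos Ineg A a g I0 \<xi> =
     {\<mu> \<in> finite_energy_vectors \<kappa> Ipos Ineg A.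
        (\<forall>i\<in>Ipos \<union> Ineg. pairing (\<lambda>x. ereal (g i x)) (\<mu> i) = ereal (a i))
        \<and> (\<forall>i\<in>I0. measure_le (\<mu> i) (\<xi> i))
        \<and> (\<forall>i\<in>Ipos \<union> Ineg. radon_integrable (\<mu> i) (f i))
        \<and> series_finite (field_terms f \<mu>) (Ipos \<union> Ineg)}"

definition is_solution ::
    "('a::topological_space \<times> 'a \<Rightarrow> ereal) \<Rightarrow> ('i \<Rightarrow> 'a \<Rightarrow> ereal) \<Rightarrow> 'i set \<Rightarrow> 'i set
       \<Rightarrow> ('i \<Rightarrow> 'a set) \<Rightarrow> ('i \<Rightarrow> real) \<Rightarrow> ('i \<Rightarrow> 'a \<Rightarrow> real) \<Rightarrow> 'i set \<Rightarrow> ('i \<Rightarrow> 'a measure)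
       \<Rightarrow> ('i \<Rightarrow> 'a measure) \<Rightarrow> bool" where
  "is_solution \<kappa> f Ipos Ineg A a g I0 \<xi> \<mu> \<longleftrightarrow>
     \<mu> \<in> admissible \<kappa> f Ipos Ineg A a g I0 \<xi>
     \<and> ereal (gauss_functional \<kappa> Ipos Ineg f \<mu>)
        = (INF \<nu>\<in>admissible \<kappa> f Ipos Ineg A a g I0 \<xi>. ereal (gauss_functional \<kappa> Ipos Ineg f \<nu>))"

end

theory Submission
  imports Defs
begin

text \<open>
  The admissible class is closed under midpoints and the energy is a quadratic form, so the
  parallelogram identity gives
  \<open>\<parallel>\<lambda> - \<lambda>'\<parallel>\<^sup>2 = 2 G \<lambda> + 2 G \<lambda>' - 4 G ((\<lambda> + \<lambda>') / 2) \<le> 0\<close> for two minimizers.  On the other hand the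
  left-hand side is a limit of energies of signed Radon measures, one for each finite set of
  plates, and these are nonnegative by positive definiteness.  The same positivity,
  \<open>\<kappa>(P, N) + \<kappa>(N, P) \<le> \<kappa>(P, P) + \<kappa>(N, N)\<close>, makes the mixed series converge when \<open>\<kappa> \<ge> 0\<close>;
  otherwise \<open>X\<close> is compact and there are only finitely many plates.  All of this rests on
  the bilinearity of the mutual energy, that is, on existence and uniqueness of the Radon product
  and of the Jordan decomposition.
\<close>

section \<open>Sums and comparison of Radon measures\<close>

text \<open>The Borel sets of \<open>X \<times> X\<close> need not lie in the product of the Borel
  sigma-algebras, so the usual product measure and its Fubini theorem cannot serve for a lower
  semicontinuous kernel. The Radon product is therefore built from iterated integrals over compact
  rectangles, where all masses are finite, and compact sets have to carry both existence and
  uniqueness. A second obstacle is that Radon measures on \<open>X\<close> need not be sigma-finite,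
  while the Jordan parts of a difference are obtained here from Radon-Nikodym densities. The
  normalization of the integral of \<open>g i\<close> to \<open>a i\<close>, with \<open>g i\<close>
  positive and continuous, makes every admissible component sigma-finite. Energies live in
  \<open>ereal\<close>. Every kernel is bounded below, by 0 unless \<open>X\<close> is compact, so
  no mutual energy of Radon measures is \<open>- \<infinity>\<close> and finiteness passes from a
  sum to its summands. No infinite sum of components is ever formed as a measure: positivity is
  applied to finite sums, and the passage to series is made on the level of numbers.\<close>

definition add_measure :: "'a measure \<Rightarrow> 'a measure \<Rightarrow> 'a measure" where
  "add_measure M N = measure_of (space M) (sets M) (\<lambda>A. emeasure M A + emeasure N A)"

lemma space_add_measure [simp]: "space (add_measure M N) = space M"
  by (simp add: add_measure_def)

lemma sets_add_measure [simp, measurable_cong]: "sets (add_measure M N) = sets M"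
  by (simp add: add_measure_def)

lemma emeasure_add_measure:
  assumes "sets N = sets M"
  shows "emeasure (add_measure M N) A = emeasure M A + emeasure N A"
proof (cases "A \<in> sets M")
  case True
  have "countably_additive (sets M) (\<lambda>A. emeasure M A + emeasure N A)"
  proof (rule countably_additiveI)
    fix B :: "nat \<Rightarrow> _" assume B: "range B \<subseteq> sets M" "disjoint_family B"
    then show "(\<Sum>i. emeasure M (B i) + emeasure N (B i)) = emeasure M (\<Union> (range B)) + emeasure N (\<Union> (range B))"
      using assms by (subst suminf_add[symmetric]) (auto simp: suminf_emeasure)
  qed
  then show ?thesis
    unfolding add_measure_def using True
    by (intro emeasure_measure_of_sigma)
       (auto simp: positive_def sets.sigma_algebra_axioms)
next
  case False
  then show ?thesis using assms by (simp add: emeasure_notin_sets)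
qed

lemma nn_integral_add_measure:
  assumes [simp]: "sets N = sets M" and "u \<in> borel_measurable M"
  shows "nn_integral (add_measure M N) u = nn_integral M u + nn_integral N u"
  using assms(2)
proof (induction rule: borel_measurable_induct)
  case (cong f g)
  have "space N = space M" using sets_eq_imp_space_eq[OF assms(1)] .
  with cong show ?case
    by (metis (no_types, lifting) nn_integral_cong space_add_measure)
next
  case (set A)
  then show ?case by (simp add: emeasure_add_measure)
next
  case (mult u c)
  from mult(2) have "u \<in> borel_measurable N" "u \<in> borel_measurable (add_measure M N)"
    by (simp_all cong: measurable_cong_sets)
  with mult show ?case by (simp add: nn_integral_cmult distrib_left)
next
  case (add u v)
  from add(1,3) have "u \<in> borel_measurable N" "u \<in> borel_measurable (add_measure M N)"
     "v \<in> borel_measurable N" "v \<in> borel_measurable (add_measure M N)"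
    by (simp_all cong: measurable_cong_sets)
  with add show ?case by (simp add: nn_integral_add ac_simps)
next
  case (seq U)
  from seq(1) have m: "\<And>i. U i \<in> borel_measurable N" "\<And>i. U i \<in> borel_measurable (add_measure M N)"
    by (simp_all cong: measurable_cong_sets)
  have inc: "incseq (\<lambda>i. integral\<^sup>N M (U i))" "incseq (\<lambda>i. integral\<^sup>N N (U i))"
    using seq(3) by (auto intro!: nn_integral_mono simp: incseq_def le_fun_def)
  show ?case
    using seq m inc
    by (simp add: nn_integral_monotone_convergence_SUP ennreal_SUP_add image_comp SUP_apply[abs_def])
qed

lemma radon_sets: "radon \<mu> \<Longrightarrow> sets \<mu> = sets borel"
  by (simp add: radon_def)

lemma radon_space: "radon \<mu> \<Longrightarrow> space \<mu> = UNIV"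
  using sets_eq_imp_space_eq[of \<mu> borel] by (simp add: radon_def)

lemma radon_compact_finite: "radon \<mu> \<Longrightarrow> compact K \<Longrightarrow> emeasure \<mu> K < \<infinity>"
  by (simp add: radon_def)

lemma radon_inner:
  "radon \<mu> \<Longrightarrow> B \<in> sets borel \<Longrightarrow> emeasure \<mu> B = (SUP K\<in>{K. compact K \<and> K \<subseteq> B}. emeasure \<mu> K)"
  by (simp add: radon_def)

lemma radon_less_compactE:
  assumes "radon \<mu>" "B \<in> sets borel" "c < emeasure \<mu> B"
  obtains K where "compact K" "K \<subseteq> B" "c < emeasure \<mu> K"
  using assms radon_inner[OF assms(1,2)] by (auto simp: less_SUP_iff)

text \<open>By density of the order on \<open>ennreal\<close> it is enough to reach every
  \<open>c\<close> strictly below the measure, and a non-strict bound suffices; this is the form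
  that subtraction arguments deliver.\<close>

lemma radonI:
  assumes "sets \<mu> = sets borel" "\<And>K. compact K \<Longrightarrow> emeasure \<mu> K < \<infinity>"
    and "\<And>B c. B \<in> sets borel \<Longrightarrow> c < emeasure \<mu> B \<Longrightarrow> \<exists>K. compact K \<and> K \<subseteq> B \<and> c \<le> emeasure \<mu> K"
  shows "radon \<mu>"
  unfolding radon_def
proof (intro conjI ballI allI impI)
  fix B :: "'a set" assume B: "B \<in> sets borel"
  show "emeasure \<mu> B = (SUP K\<in>{K. compact K \<and> K \<subseteq> B}. emeasure \<mu> K)"
  proof (rule antisym)
    show "emeasure \<mu> B \<le> (SUP K\<in>{K. compact K \<and> K \<subseteq> B}. emeasure \<mu> K)"
    proof (rule dense_le)
      fix c assume "c < emeasure \<mu> B"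
      from assms(3)[OF B this] obtain K where "compact K" "K \<subseteq> B" "c \<le> emeasure \<mu> K" by blast
      then show "c \<le> (SUP K\<in>{K. compact K \<and> K \<subseteq> B}. emeasure \<mu> K)"
        by (intro SUP_upper2[of K]) auto
    qed
    show "(SUP K\<in>{K. compact K \<and> K \<subseteq> B}. emeasure \<mu> K) \<le> emeasure \<mu> B"
      using B assms(1) by (intro SUP_least emeasure_mono) auto
  qed
qed (use assms in auto)

lemma radon_eqI:
  assumes "radon \<mu>" "radon \<nu>" "\<And>K. compact K \<Longrightarrow> emeasure \<mu> K = emeasure \<nu> K"
  shows "\<mu> = \<nu>"
proof (rule measure_eqI)
  fix B assume "B \<in> sets \<mu>"
  then have B: "B \<in> sets borel" using assms by (simp add: radon_sets)
  show "emeasure \<mu> B = emeasure \<nu> B"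
    unfolding radon_inner[OF assms(1) B] radon_inner[OF assms(2) B]
    using assms(3) by (intro SUP_cong) auto
qed (use assms in \<open>simp add: radon_sets\<close>)

lemma compact_borel [measurable]: "compact (K :: 'a::t2_space set) \<Longrightarrow> K \<in> sets borel"
  by (simp add: compact_imp_closed)

lemma radon_approx:
  fixes \<mu> :: "'a::t2_space measure"
  assumes "radon \<mu>" "B \<in> sets borel" "emeasure \<mu> B < \<infinity>" "0 < e"
  obtains K where "compact K" "K \<subseteq> B" "emeasure \<mu> (B - K) \<le> e"
\<comment> \<open>In this case the empty set serves; it includes measure 0, where
  \<open>emeasure \<mu> B - e\<close> would not be strictly smaller than
  \<open>emeasure \<mu> B\<close>.\<close>
proof (cases "emeasure \<mu> B \<le> e")
  case True
  then show ?thesis by (intro that[of "{}"]) auto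
next
  case False
  then have "emeasure \<mu> B - e < emeasure \<mu> B"
    using assms by (intro ennreal_between) auto
  from radon_less_compactE[OF assms(1,2) this] obtain K
    where K: "compact K" "K \<subseteq> B" "emeasure \<mu> B - e < emeasure \<mu> K" by blast
  have "emeasure \<mu> (B - K) = emeasure \<mu> B - emeasure \<mu> K"
    using K assms radon_compact_finite[OF assms(1) K(1)]
    by (intro emeasure_Diff) (auto simp: radon_sets)
  also have "\<dots> \<le> e"
    using less_imp_le[OF K(3)] assms(3) by (auto simp: ennreal_minus_le_iff add.commute)
  finally show ?thesis using K by (intro that[of K])
qed

text \<open>Compact sets that approximate \<open>B\<close> for the two measures separately may be
  replaced by their union, so the double supremum collapses to a single one.\<close>

lemma radon_add_measure:
  fixes \<mu> \<nu> :: "'a::t2_space measure"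
  assumes "radon \<mu>" "radon \<nu>"
  shows "radon (add_measure \<mu> \<nu>)"
proof -
  note [simp] = radon_sets[OF assms(1)] radon_sets[OF assms(2)]
  have e: "emeasure (add_measure \<mu> \<nu>) B = emeasure \<mu> B + emeasure \<nu> B" for B
    using assms by (simp add: emeasure_add_measure)
  show ?thesis
    unfolding radon_def
  proof (intro conjI ballI allI impI)
    fix B :: "'a set" assume B: "B \<in> sets borel"
    let ?S = "{K. compact K \<and> K \<subseteq> B}"
    have ne: "?S \<noteq> {}" by (auto intro: exI[of _ "{}"])
    have "emeasure \<mu> B + emeasure \<nu> B = (SUP L\<in>?S. SUP K\<in>?S. emeasure \<mu> K + emeasure \<nu> L)"
      unfolding radon_inner[OF assms(1) B] radon_inner[OF assms(2) B]
      unfolding ennreal_SUP_add_left[OF ne, symmetric] ennreal_SUP_add_right[OF ne] ..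
    also have "\<dots> \<le> (SUP K\<in>?S. emeasure (add_measure \<mu> \<nu>) K)"
    proof (intro SUP_least)
      fix K L assume KL: "K \<in> ?S" "L \<in> ?S"
      then have "emeasure \<mu> K + emeasure \<nu> L \<le> emeasure (add_measure \<mu> \<nu>) (K \<union> L)"
        unfolding e using assms by (intro add_mono emeasure_mono) auto
      also have "\<dots> \<le> (SUP K\<in>?S. emeasure (add_measure \<mu> \<nu>) K)"
        using KL by (intro SUP_upper) auto
      finally show "emeasure \<mu> K + emeasure \<nu> L \<le> (SUP K\<in>?S. emeasure (add_measure \<mu> \<nu>) K)" .
    qed
    finally have "emeasure (add_measure \<mu> \<nu>) B \<le> (SUP K\<in>?S. emeasure (add_measure \<mu> \<nu>) K)"
      by (simp add: e)
    moreover have "(SUP K\<in>?S. emeasure (add_measure \<mu> \<nu>) K) \<le> emeasure (add_measure \<mu> \<nu>) B"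
      using B assms by (intro SUP_least emeasure_mono) auto
    ultimately show "emeasure (add_measure \<mu> \<nu>) B = (SUP K\<in>?S. emeasure (add_measure \<mu> \<nu>) K)"
      by (rule antisym)
  next
    fix K :: "'a set" assume "compact K"
    then show "emeasure (add_measure \<mu> \<nu>) K < \<infinity>"
      using radon_compact_finite[OF assms(1)] radon_compact_finite[OF assms(2)] by (simp add: e)
  qed simp
qed

lemma radon_scale_measure:
  assumes "radon \<mu>" "c < \<infinity>"
  shows "radon (scale_measure c \<mu>)"
  using assms
  by (auto simp: radon_def ennreal_mult_less_top SUP_mult_left_ennreal)

text \<open>Under \<open>c < b < \<infinity>\<close> the truncated difference is a genuine one. The
  lemma turns "the remainder has measure at most \<open>b - c\<close>" into "the inner piece has
  measure at least \<open>c\<close>".\<close>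

lemma ennreal_le_if_le_add_diff:
  fixes b c x :: ennreal
  assumes "b \<le> x + (b - c)" "c < b" "b < \<infinity>"
  shows "c \<le> x"
  using assms
  by (cases x; cases c; cases b)
     (auto simp: ennreal_minus ennreal_less_iff ennreal_plus[symmetric] simp del: ennreal_plus)

text \<open>On a piece of finite \<open>\<mu>\<close>-measure, a compact set whose complement in the
  piece is \<open>\<mu>\<close>-small leaves a remainder that is also \<open>\<tau>\<close>-small.
  The sets \<open>A n\<close> supply such pieces and exhaust the space up to a
  \<open>\<tau>\<close>-null set.\<close>

lemma radon_le:
  fixes \<mu> :: "'a::t2_space measure"
  assumes r: "radon \<mu>" and s: "sets \<tau> = sets borel"
    and le: "\<And>B. B \<in> sets borel \<Longrightarrow> emeasure \<tau> B \<le> emeasure \<mu> B"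
    and A: "incseq A" "\<And>n::nat. A n \<in> sets borel" "\<And>n. emeasure \<mu> (A n) < \<infinity>"
    and null: "emeasure \<tau> (- (\<Union>n. A n)) = 0"
  shows "radon \<tau>"
proof -
  note [simp] = radon_sets[OF r] s
  show ?thesis
  proof (rule radonI)
    show "emeasure \<tau> K < \<infinity>" if "compact K" for K
      using le[of K] that radon_compact_finite[OF r that] by (auto intro: le_less_trans)
  next
    fix B c assume B: "B \<in> sets borel" and c: "c < emeasure \<tau> B"
    have "emeasure \<tau> B \<le> emeasure \<tau> ((\<Union>n. B \<inter> A n) \<union> (- (\<Union>n. A n)))"
      using B A s by (intro emeasure_mono) auto
    also have "\<dots> \<le> emeasure \<tau> (\<Union>n. B \<inter> A n) + emeasure \<tau> (- (\<Union>n. A n))"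
      using B A s by (intro emeasure_subadditive) auto
    also have "\<dots> = (SUP n. emeasure \<tau> (B \<inter> A n))"
      using B A s null by (subst SUP_emeasure_incseq) (auto simp: incseq_def)
    finally have "c < (SUP n. emeasure \<tau> (B \<inter> A n))" using c by simp
    then obtain n where n: "c < emeasure \<tau> (B \<inter> A n)" by (auto simp: less_SUP_iff)
    have BA: "B \<inter> A n \<in> sets borel" using B A by auto
    have fin: "emeasure \<mu> (B \<inter> A n) < \<infinity>"
      using A B r by (intro le_less_trans[OF emeasure_mono A(3)[of n]]) auto
    have "0 < emeasure \<tau> (B \<inter> A n) - c" using n by (rule diff_gr0_ennreal)
    then obtain K where K: "compact K" "K \<subseteq> B \<inter> A n" "emeasure \<mu> (B \<inter> A n - K) \<le> emeasure \<tau> (B \<inter> A n) - c"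
      using radon_approx[OF r BA fin] by blast
    have "emeasure \<tau> (B \<inter> A n) = emeasure \<tau> K + emeasure \<tau> (B \<inter> A n - K)"
      using K BA s by (subst plus_emeasure) (auto simp: Un_absorb1)
    also have "emeasure \<tau> (B \<inter> A n - K) \<le> emeasure \<tau> (B \<inter> A n) - c"
      using le[of "B \<inter> A n - K"] K BA by (intro order_trans[OF _ K(3)]) auto
    finally have *: "emeasure \<tau> (B \<inter> A n) \<le> emeasure \<tau> K + (emeasure \<tau> (B \<inter> A n) - c)" by simp
    have "emeasure \<tau> (B \<inter> A n) < \<infinity>" using le[OF BA] fin by simp
    with * n have "c \<le> emeasure \<tau> K" by (rule ennreal_le_if_le_add_diff)
    then show "\<exists>K. compact K \<and> K \<subseteq> B \<and> c \<le> emeasure \<tau> K" using K by auto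
  qed (fact s)
qed

section \<open>Regularity\<close>

lemma locally_compact_nbhdE:
  fixes x :: "'a::t2_space"
  assumes "locally_compact_space (euclidean :: 'a topology)" "open U" "x \<in> U"
  obtains V Q where "open V" "compact Q" "x \<in> V" "V \<subseteq> Q" "Q \<subseteq> U"
proof -
  have "Hausdorff_space (euclidean :: 'a topology)"
    unfolding Hausdorff_space_def disjnt_def using hausdorff by fastforce
  then have "neighbourhood_base_of (compactin (euclidean :: 'a topology)) euclidean"
    using assms(1) by (subst locally_compact_space_neighbourhood_base[symmetric]) auto
  then show ?thesis
    using assms that unfolding neighbourhood_base_of by (metis compactin_euclidean_iff open_openin)
qed

text \<open>Since \<open>e\<close> may be infinite, a positive real below \<open>e\<close> is chosen
  before it is split geometrically.\<close>

lemma ennreal_suminf_posE: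
  fixes e :: ennreal
  assumes "0 < e"
  obtains r :: "nat \<Rightarrow> ennreal" where "\<And>n. 0 < r n" "(\<Sum>n. r n) < e"
proof -
  obtain d where d: "0 < d" "d < e" using dense[OF assms] by blast
  then obtain d' where d': "d = ennreal d'" "0 < d'"
    by (cases d) (auto simp: ennreal_less_iff)
  have "(\<lambda>n. d' * (1/2)^Suc n) sums (d' * 1)"
    by (intro sums_mult power_half_series)
  then have "(\<Sum>n. ennreal (d' * (1/2)^Suc n)) = ennreal d'"
    using d' by (subst suminf_ennreal2) (auto simp: sums_iff)
  then have "(\<Sum>n. ennreal (d' * (1/2)^Suc n)) < e" using d(2) d'(1) by (simp only:)
  moreover have "0 < ennreal (d' * (1/2)^Suc n)" for n
    using d'(2) by (simp only: ennreal_less_zero_iff) simp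
  ultimately show ?thesis by (rule that[rotated])
qed

text \<open>The Borel sets for which both the set and its complement can be approximated from inside
  form a sigma-algebra. It contains the open sets: for the complement of an open \<open>G\<close>, a
  compact set that nearly exhausts the space is cut down by \<open>G\<close>.\<close>

lemma finite_inner_regular_if_open:
  fixes m :: "'a::t2_space measure"
  assumes sets_m: "sets m = sets borel" and fin: "emeasure m UNIV < \<infinity>"
    and op: "\<And>G e. open G \<Longrightarrow> 0 < e \<Longrightarrow> \<exists>C. compact C \<and> C \<subseteq> G \<and> emeasure m (G - C) \<le> e"
    and "B \<in> sets borel" "0 < e"
  shows "\<exists>C. compact C \<and> C \<subseteq> B \<and> emeasure m (B - C) \<le> e"
proof -
  note [simp, measurable_cong] = sets_m
  define P where "P B \<longleftrightarrow> (\<forall>e>0. \<exists>C. compact C \<and> C \<subseteq> B \<and> emeasure m (B - C) \<le> e)" for B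
  have finB: "emeasure m B < \<infinity>" for B
    using emeasure_space[of m B] fin sets_eq_imp_space_eq[OF sets_m] by (simp add: le_less_trans)
  have PE: "\<exists>C. \<forall>n::nat. compact (C n) \<and> C n \<subseteq> A n \<and> emeasure m (A n - C n) \<le> r n"
    if "\<And>n. P (A n)" "\<And>n. 0 < r n" for A r
    using that unfolding P_def by (intro choice) blast
  have "P B \<and> P (UNIV - B)" if "B \<in> sigma_sets UNIV {S. open S}" for B
    using that
  proof induction
    case (Basic G)
    then have G: "open G" by simp
    have "P G" using op[OF G] by (auto simp: P_def)
    moreover have "P (UNIV - G)"
      unfolding P_def
    proof (intro allI impI)
      fix e :: ennreal assume "0 < e"
      from op[OF open_UNIV this] obtain C where C: "compact C" "emeasure m (UNIV - C) \<le> e" by blast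
      have "compact (C - G)" using C G by (simp add: compact_diff)
      moreover have "emeasure m (UNIV - G - (C - G)) \<le> emeasure m (UNIV - C)"
        using C G by (intro emeasure_mono) auto
      ultimately show "\<exists>C. compact C \<and> C \<subseteq> UNIV - G \<and> emeasure m (UNIV - G - C) \<le> e"
        using C by (intro exI[of _ "C - G"]) auto
    qed
    ultimately show ?case ..
  next
    case Empty
    show ?case using op[OF open_UNIV] unfolding P_def by (auto intro: exI[of _ "{}"])
  next
    case (Compl A)
    then show ?case by (simp add: double_diff)
  next
    case (Union A)
    have A[measurable]: "A n \<in> sets borel" for n using Union(1) by (simp add: sets_borel)
    have "P (\<Union>n. A n)"
      unfolding P_def
    proof (intro allI impI)
      fix e :: ennreal assume "0 < e"
      from ennreal_suminf_posE[OF this] obtain r where r: "\<And>n. 0 < r n" "(\<Sum>n::nat. r n) < e" by blast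
      from PE[of A r] r Union(2) obtain C
        where C: "\<And>n. compact (C n)" "\<And>n. C n \<subseteq> A n" "\<And>n. emeasure m (A n - C n) \<le> r n" by blast
      note [measurable] = compact_borel[OF C(1)]
      \<comment> \<open>Only finitely many \<open>C n\<close> can be united without risking
        compactness. Finiteness of \<open>m\<close> gives continuity from above, so the remainders
        of the finite unions decrease to that of the full union.\<close>
      define D where "D N = (\<Union>n<N. C n)" for N :: nat
      have [measurable]: "D N \<in> sets borel" for N unfolding D_def by measurable
      have "(INF N. emeasure m ((\<Union>n. A n) - D N)) = emeasure m (\<Inter>N. (\<Union>n. A n) - D N)"
        using finB by (intro INF_emeasure_decseq') (auto simp: decseq_def D_def less_top)
      also have "\<dots> \<le> emeasure m (\<Union>n. A n - C n)"
        by (intro emeasure_mono) (auto simp: D_def)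
      also have "\<dots> \<le> (\<Sum>n. emeasure m (A n - C n))"
        by (intro emeasure_subadditive_countably) auto
      also have "\<dots> \<le> (\<Sum>n. r n)" using C by (intro suminf_le) auto
      also have "\<dots> < e" by fact
      finally obtain N where "emeasure m ((\<Union>n. A n) - D N) < e" by (auto simp: INF_less_iff)
      moreover have "compact (D N)" unfolding D_def using C by (intro compact_UN) auto
      moreover have "D N \<subseteq> (\<Union>n. A n)" using C by (auto simp: D_def)
      ultimately show "\<exists>C. compact C \<and> C \<subseteq> (\<Union>n. A n) \<and> emeasure m ((\<Union>n. A n) - C) \<le> e"
        by (intro exI[of _ "D N"]) auto
    qed
    moreover have "P (UNIV - (\<Union>n. A n))"
      unfolding P_def
    proof (intro allI impI)
      fix e :: ennreal assume "0 < e"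
      from ennreal_suminf_posE[OF this] obtain r where r: "\<And>n. 0 < r n" "(\<Sum>n::nat. r n) < e" by blast
      from PE[of "\<lambda>n. UNIV - A n" r] r Union(2) obtain C
        where C: "\<And>n. compact (C n)" "\<And>n. C n \<subseteq> UNIV - A n" "\<And>n. emeasure m (UNIV - A n - C n) \<le> r n"
        by blast
      note [measurable] = compact_borel[OF C(1)]
      \<comment> \<open>Here no truncation to finitely many indices is needed: the countable
        intersection is closed in the compact set \<open>C 0\<close>.\<close>
      have "closed (\<Inter>n. C n)" using C by (intro closed_INT) (auto intro: compact_imp_closed)
      moreover have "(\<Inter>n. C n) = C 0 \<inter> (\<Inter>n. C n)" by auto
      ultimately have cp: "compact (\<Inter>n. C n)"
        using compact_Int_closed[OF C(1)[of 0]] by metis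
      have "emeasure m (UNIV - (\<Union>n. A n) - (\<Inter>n. C n)) \<le> emeasure m (\<Union>n. UNIV - A n - C n)"
        by (intro emeasure_mono) auto
      also have "\<dots> \<le> (\<Sum>n. emeasure m (UNIV - A n - C n))"
        by (intro emeasure_subadditive_countably) auto
      also have "\<dots> \<le> (\<Sum>n. r n)" using C by (intro suminf_le) auto
      finally show "\<exists>C. compact C \<and> C \<subseteq> UNIV - (\<Union>n. A n) \<and> emeasure m (UNIV - (\<Union>n. A n) - C) \<le> e"
        using cp C(2) r by (intro exI[of _ "\<Inter>n. C n"]) (auto dest: subsetD)
    qed
    ultimately show ?case ..
  qed
  with assms(4,5) show ?thesis by (auto simp: sets_borel P_def)
qed

text \<open>A sequence along which the measure tends to its supremum over \<open>\<C>\<close> is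
  made increasing by finite unions. A member \<open>D\<close> with positive mass outside the union
  would push some \<open>D \<union> C n\<close> above the supremum, which is finite. The sequence
  replaces a possibly uncountable union.\<close>

lemma essential_union:
  assumes fin: "emeasure m (space m) < \<infinity>" and sub: "\<C> \<subseteq> sets m" and ne: "{} \<in> \<C>"
    and un: "\<And>C D. C \<in> \<C> \<Longrightarrow> D \<in> \<C> \<Longrightarrow> C \<union> D \<in> \<C>"
  obtains C :: "nat \<Rightarrow> 'a set" where "incseq C" "\<And>n. C n \<in> \<C>"
    "\<And>D. D \<in> \<C> \<Longrightarrow> emeasure m (D - (\<Union>n. C n)) = 0"
proof -
  define s where "s = (SUP C\<in>\<C>. emeasure m C)"
  have "s \<le> emeasure m (space m)" unfolding s_def by (intro SUP_least emeasure_space)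
  then have s: "s < \<infinity>" using fin by simp
  obtain f :: "nat \<Rightarrow> ennreal" where f: "range f \<subseteq> emeasure m ` \<C>" "s = (SUP n. f n)"
    using ennreal_SUP_countable_SUP[of \<C> "emeasure m"] ne unfolding s_def by auto
  then have "\<forall>n. \<exists>B. B \<in> \<C> \<and> emeasure m B = f n" by (metis image_iff rangeI subsetD)
  then obtain B where B: "\<And>n. B n \<in> \<C>" "\<And>n. emeasure m (B n) = f n" by metis
  define C where "C n = (\<Union>k\<le>n. B k)" for n
  have C: "C n \<in> \<C>" for n
    unfolding C_def by (induction n) (auto simp: atMost_Suc B un)
  have inc: "incseq C" by (auto simp: C_def incseq_def intro: order_trans)
  have sm: "C n \<in> sets m" for n using C sub by auto
  have eqs: "s \<le> (SUP n. emeasure m (C n))"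
    unfolding f(2)
  proof (rule SUP_mono)
    fix n show "\<exists>k\<in>UNIV. f n \<le> emeasure m (C k)"
      unfolding B(2)[symmetric] using sm by (intro bexI[of _ n] emeasure_mono) (auto simp: C_def)
  qed
  show ?thesis
  proof (rule that[OF inc C])
    fix D assume D: "D \<in> \<C>"
    have "emeasure m (D - (\<Union>n. C n)) + emeasure m (C n) \<le> s" for n
    proof -
      have "emeasure m (D - (\<Union>n. C n)) + emeasure m (C n) = emeasure m ((D - (\<Union>n. C n)) \<union> C n)"
        using D sub sm by (intro plus_emeasure) auto
      also have "\<dots> \<le> emeasure m (D \<union> C n)"
        using D sub sm by (intro emeasure_mono) auto
      also have "\<dots> \<le> s" unfolding s_def using D C un by (intro SUP_upper) auto
      finally show ?thesis .
    qed
    then have "emeasure m (D - (\<Union>n. C n)) + (SUP n. emeasure m (C n)) \<le> s"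
      by (subst ennreal_SUP_add_right) (auto intro: SUP_least)
    then have "emeasure m (D - (\<Union>n. C n)) + s \<le> s"
      using order_trans[OF add_left_mono[OF eqs]] by blast
    then show "emeasure m (D - (\<Union>n. C n)) = 0"
      using s by (cases "emeasure m (D - (\<Union>n. C n))"; cases s) (auto simp: top_unique simp flip: ennreal_plus)
  qed
qed

section \<open>Products of Radon measures\<close>

lemma sets_Pair_vimage:
  fixes E :: "('a::topological_space \<times> 'b::topological_space) set"
  shows "E \<in> sets borel \<Longrightarrow> Pair x -` E \<in> sets borel"
  by (rule measurable_sets_borel[of "Pair x" borel])
     (auto intro!: borel_measurable_continuous_onI continuous_intros)

text \<open>For open \<open>E\<close> the function is lower semicontinuous: a compact
  \<open>K\<close> inside the section at \<open>x\<close> stays inside all sections at points near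
  \<open>x\<close>, by the tube lemma. The general case is a Dynkin class argument; the cut with
  \<open>L\<close> keeps the measures finite, so that complements can be subtracted.\<close>

lemma measurable_emeasure_section:
  fixes E :: "('a::t2_space \<times> 'b::t2_space) set"
  assumes \<nu>: "radon \<nu>" and L: "compact L" and E: "E \<in> sets borel"
  shows "(\<lambda>x. emeasure \<nu> (L \<inter> Pair x -` E)) \<in> borel_measurable borel"
proof -
  note [simp, measurable_cong] = radon_sets[OF \<nu>]
  note [measurable] = compact_borel[OF L]
  have fin: "emeasure \<nu> (L \<inter> B) < \<infinity>" for B
    by (rule le_less_trans[OF emeasure_mono radon_compact_finite[OF \<nu> L]]) (simp_all add: compact_borel[OF L])
  have m: "Pair x -` E \<in> sets borel" if "E \<in> sigma_sets UNIV {S. open S}" for x and E :: "('a \<times> 'b) set"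
    using that by (intro sets_Pair_vimage) (simp add: sets_borel)
  have "Int_stable {S :: ('a \<times> 'b) set. open S}" by (auto simp: Int_stable_def)
  moreover have "{S :: ('a \<times> 'b) set. open S} \<subseteq> Pow UNIV" by simp
  moreover have "E \<in> sigma_sets UNIV {S. open S}" using E by (simp add: sets_borel)
  ultimately show ?thesis
  proof (induction rule: sigma_sets_induct_disjoint)
    case (basic G)
    then have G: "open G" by simp
    show ?case
    proof (rule borel_measurableI_greater)
      fix y
      have "open {x. y < emeasure \<nu> (L \<inter> Pair x -` G)}"
      proof (subst open_subopen, safe)
        fix x assume y: "y < emeasure \<nu> (L \<inter> Pair x -` G)"
        have "L \<inter> Pair x -` G \<in> sets borel" using G by (auto intro!: sets_Pair_vimage)
        from radon_less_compactE[OF \<nu> this y] obtain K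
          where K: "compact K" "K \<subseteq> L \<inter> Pair x -` G" "y < emeasure \<nu> K" by blast
        have "{x} \<times> K \<subseteq> G" using K by auto
        from Elementary_Topology.tube_lemma[OF K(1) G this] obtain W
          where W: "x \<in> W" "open W" "W \<times> K \<subseteq> G" by blast
        have "y < emeasure \<nu> (L \<inter> Pair x' -` G)" if "x' \<in> W" for x'
          using W K that G by (intro less_le_trans[OF K(3)] emeasure_mono) (auto intro!: sets_Pair_vimage)
        then show "\<exists>T. open T \<and> x \<in> T \<and> T \<subseteq> {x. y < emeasure \<nu> (L \<inter> Pair x -` G)}"
          using W by blast
      qed
      then show "{x \<in> space borel. y < emeasure \<nu> (L \<inter> Pair x -` G)} \<in> sets borel" by simp
    qed
  next
    case (compl A)
    have "emeasure \<nu> (L \<inter> Pair x -` (UNIV - A)) = emeasure \<nu> L - emeasure \<nu> (L \<inter> Pair x -` A)" for x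
    proof -
      have "L \<inter> Pair x -` (UNIV - A) = L - (L \<inter> Pair x -` A)" by auto
      then show ?thesis using m[OF compl(1)] fin by (simp add: emeasure_Diff less_top)
    qed
    with compl show ?case by simp
  next
    case (union A)
    have "emeasure \<nu> (L \<inter> Pair x -` (\<Union>i. A i)) = (\<Sum>i. emeasure \<nu> (L \<inter> Pair x -` (A i)))" for x
    proof -
      have "L \<inter> Pair x -` (\<Union>i. A i) = (\<Union>i. L \<inter> Pair x -` A i)" by auto
      moreover have "disjoint_family (\<lambda>i. L \<inter> Pair x -` A i)"
        using union(1) by (auto simp: disjoint_family_on_def)
      moreover have "L \<inter> Pair x -` A i \<in> sets \<nu>" for i
        using m[of "A i" x] union(2) compact_borel[OF L] by (auto intro!: sets.Int)
      ultimately show ?thesis by (simp add: suminf_emeasure image_subset_iff)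
    qed
    with union show ?case by simp
  qed simp_all
qed

text \<open>The restriction of the product to \<open>K \<times> L\<close>, written as an iterated
  integral. It lives on all Borel sets of the product space, and compactness of \<open>K\<close> and
  \<open>L\<close> makes its total mass finite.\<close>

definition section_measure :: "'a::topological_space measure \<Rightarrow> 'b::topological_space measure \<Rightarrow>
    'a set \<Rightarrow> 'b set \<Rightarrow> ('a \<times> 'b) measure" where
  "section_measure \<mu> \<nu> K L = measure_of UNIV (sets borel)
     (\<lambda>E. \<integral>\<^sup>+x. emeasure \<nu> (L \<inter> Pair x -` E) * indicator K x \<partial>\<mu>)"

lemma sets_section_measure [simp, measurable_cong]: "sets (section_measure \<mu> \<nu> K L) = sets borel"
  unfolding section_measure_def using sets.sets_measure_of_eq[of borel] by simp

lemma emeasure_section_measure: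
  fixes \<mu> :: "'a::t2_space measure" and \<nu> :: "'b::t2_space measure"
  assumes \<mu>: "radon \<mu>" and \<nu>: "radon \<nu>" and K: "compact K" and L: "compact L" and E: "E \<in> sets borel"
  shows "emeasure (section_measure \<mu> \<nu> K L) E = (\<integral>\<^sup>+x. emeasure \<nu> (L \<inter> Pair x -` E) * indicator K x \<partial>\<mu>)"
  unfolding section_measure_def
proof (rule emeasure_measure_of_sigma[OF _ _ _ E])
  note [simp, measurable_cong] = radon_sets[OF \<mu>] radon_sets[OF \<nu>]
  note [measurable] = compact_borel[OF K] measurable_emeasure_section[OF \<nu> L]
  show "sigma_algebra UNIV (sets (borel :: ('a \<times> 'b) measure))"
    using sets.sigma_algebra_axioms[of "borel :: ('a \<times> 'b) measure"] by simp
  show "positive (sets borel) (\<lambda>E. \<integral>\<^sup>+x. emeasure \<nu> (L \<inter> Pair x -` E) * indicator K x \<partial>\<mu>)"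
    by (simp add: positive_def)
  show "countably_additive (sets borel) (\<lambda>E. \<integral>\<^sup>+x. emeasure \<nu> (L \<inter> Pair x -` E) * indicator K x \<partial>\<mu>)"
  proof (rule countably_additiveI)
    fix A :: "nat \<Rightarrow> ('a \<times> 'b) set" assume A: "range A \<subseteq> sets borel" "disjoint_family A"
    have [measurable]: "A i \<in> sets borel" for i using A by auto
    have "(\<Sum>i. emeasure \<nu> (L \<inter> Pair x -` A i)) = emeasure \<nu> (L \<inter> Pair x -` (\<Union>i. A i))" for x
    proof -
      have "L \<inter> Pair x -` (\<Union>i. A i) = (\<Union>i. L \<inter> Pair x -` A i)" by auto
      moreover have "disjoint_family (\<lambda>i. L \<inter> Pair x -` A i)"
        using A(2) by (auto simp: disjoint_family_on_def)
      moreover have "L \<inter> Pair x -` A i \<in> sets \<nu>" for i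
        using compact_borel[OF L] sets_Pair_vimage[of "A i" x] by simp
      ultimately show ?thesis by (simp add: suminf_emeasure image_subset_iff)
    qed
    then show "(\<Sum>i. \<integral>\<^sup>+x. emeasure \<nu> (L \<inter> Pair x -` A i) * indicator K x \<partial>\<mu>)
        = (\<integral>\<^sup>+x. emeasure \<nu> (L \<inter> Pair x -` (\<Union>i. A i)) * indicator K x \<partial>\<mu>)"
      by (subst nn_integral_suminf[symmetric]) (simp_all add: ennreal_suminf_multc)
  qed
qed

text \<open>The compact subsets of an open \<open>G\<close> have an essential union \<open>G'\<close>; it exhausts \<open>G\<close> because
  on each set \<open>{x. \<nu> G'\<^sub>x < r < \<nu> G\<^sub>x}\<close> the tube lemma produces compact rectangles in \<open>G\<close> that are
  not contained in \<open>G'\<close> up to a null set.\<close>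

lemma section_measure_open_regular:
  fixes \<mu> :: "'a::t2_space measure" and \<nu> :: "'b::t2_space measure"
  assumes lc: "locally_compact_space (euclidean :: 'a topology)"
    and \<mu>: "radon \<mu>" and \<nu>: "radon \<nu>" and K: "compact K" and L: "compact L"
    and G: "open G" and e: "0 < e"
  defines "m \<equiv> section_measure \<mu> \<nu> K L"
  shows "\<exists>C. compact C \<and> C \<subseteq> G \<and> emeasure m (G - C) \<le> e"
proof -
  note [simp, measurable_cong] = radon_sets[OF \<mu>] radon_sets[OF \<nu>]
  note [simp] = radon_space[OF \<mu>] radon_space[OF \<nu>]
  note Kb [measurable] = compact_borel[OF K]
  note Lb [measurable] = compact_borel[OF L]
  note sect [measurable] = measurable_emeasure_section[OF \<nu> L]
  have [simp]: "sets m = sets borel" by (simp add: m_def)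
  have [simp]: "space m = UNIV" using sets_eq_imp_space_eq[of m borel] by simp
  have em: "emeasure m E = (\<integral>\<^sup>+x. emeasure \<nu> (L \<inter> Pair x -` E) * indicator K x \<partial>\<mu>)"
    if "E \<in> sets borel" for E
    unfolding m_def using emeasure_section_measure[OF \<mu> \<nu> K L that] .
  have finL: "emeasure \<nu> (L \<inter> B) < \<infinity>" for B
    by (rule le_less_trans[OF emeasure_mono radon_compact_finite[OF \<nu> L]]) (simp_all add: Lb)
  have "emeasure m UNIV = emeasure \<nu> L * emeasure \<mu> K"
    using Kb by (simp add: em nn_integral_cmult)
  also have "\<dots> < \<infinity>"
    using radon_compact_finite[OF \<mu> K] radon_compact_finite[OF \<nu> L] by (simp add: ennreal_mult_less_top)
  finally have fin: "emeasure m UNIV < \<infinity>" .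
  have finm: "emeasure m B < \<infinity>" for B
    by (rule le_less_trans[OF emeasure_mono fin]) simp_all
  obtain C where C: "incseq C" "\<And>n::nat. C n \<in> {C. compact C \<and> C \<subseteq> G}"
    and Cnull: "\<And>D. D \<in> {C. compact C \<and> C \<subseteq> G} \<Longrightarrow> emeasure m (D - (\<Union>n. C n)) = 0"
    by (rule essential_union[of m "{C. compact C \<and> C \<subseteq> G}"]) (use fin in \<open>auto simp: compact_imp_closed\<close>)
  define G' where "G' = (\<Union>n. C n)"
  have Cb: "C n \<in> sets borel" for n using C(2)[of n] by (simp add: compact_borel)
  have G'b: "G' \<in> sets borel" unfolding G'_def using Cb by auto
  have Gb: "G \<in> sets borel" using G by simp
  have G'G: "G' \<subseteq> G" using C(2) by (auto simp: G'_def)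
  define a where "a x = emeasure \<nu> (L \<inter> Pair x -` G')" for x
  define b where "b x = emeasure \<nu> (L \<inter> Pair x -` G)" for x
  have [measurable]: "a \<in> borel_measurable borel" "b \<in> borel_measurable borel"
    unfolding a_def b_def using G'b Gb sect by simp_all
  \<comment> \<open>Every gap \<open>a x < b x\<close> contains some \<open>r \<in> D\<close>, so it
    suffices to show that the countably many sets \<open>T r\<close> are null.\<close>
  obtain D :: "ennreal set" where D: "countable D" "\<And>X. open X \<Longrightarrow> X \<noteq> {} \<Longrightarrow> \<exists>d\<in>D. d \<in> X"
    using countable_dense_setE by blast
  define T where "T r = {x\<in>K. a x < r \<and> r < b x}" for r
  have Tb: "T r \<in> sets borel" for r
  proof -
    have "T r = {x\<in>space borel. x \<in> K \<and> a x < r \<and> r < b x}" by (simp add: T_def)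
    also have "\<dots> \<in> sets borel" by measurable
    finally show ?thesis .
  qed
  \<comment> \<open>The compact rectangle \<open>Q \<times> M\<close> lies in \<open>G\<close>,
    hence in \<open>G'\<close> up to an \<open>m\<close>-null set. Over a point of
    \<open>Q \<inter> T'\<close> where the section of this null set is null,
    \<open>emeasure \<nu> M \<le> a x < r\<close> would follow.\<close>
  have rect: "emeasure \<mu> (Q \<inter> T') = 0"
    if T': "compact T'" "T' \<subseteq> T r" and Q: "compact Q" and M: "compact M" "M \<subseteq> L" "Q \<times> M \<subseteq> G" "r < emeasure \<nu> M"
    for Q T' M r
  proof -
    note [measurable] = compact_borel[OF Q] compact_borel[OF T'(1)] compact_borel[OF M(1)]
    have b1: "Q \<times> M - G' \<in> sets borel"
      using G'b Q M by (simp add: compact_borel compact_Times sets.Diff)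
    have "emeasure m (Q \<times> M - G') = 0" unfolding G'_def using Q M by (intro Cnull) (auto intro: compact_Times)
    then have "AE x in \<mu>. emeasure \<nu> (L \<inter> Pair x -` (Q \<times> M - G')) * indicator K x = 0"
      using sect[OF b1] by (simp add: em[OF b1] nn_integral_0_iff_AE)
    moreover have "emeasure \<nu> (L \<inter> Pair x -` (Q \<times> M - G')) * indicator K x \<noteq> 0" if x: "x \<in> Q \<inter> T'" for x
    proof
      assume "emeasure \<nu> (L \<inter> Pair x -` (Q \<times> M - G')) * indicator K x = 0"
      moreover have xT: "x \<in> K" "a x < r" using x T' by (auto simp: T_def)
      ultimately have 0: "emeasure \<nu> (L \<inter> Pair x -` (Q \<times> M - G')) = 0" by simp
      have "emeasure \<nu> M \<le> emeasure \<nu> ((L \<inter> Pair x -` (Q \<times> M - G')) \<union> (L \<inter> Pair x -` G'))"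
        using x M(2) sets_Pair_vimage[OF b1, of x] sets_Pair_vimage[OF G'b, of x] by (intro emeasure_mono) auto
      also have "\<dots> \<le> emeasure \<nu> (L \<inter> Pair x -` (Q \<times> M - G')) + a x"
        unfolding a_def
        using sets_Pair_vimage[OF b1, of x] sets_Pair_vimage[OF G'b, of x] by (intro emeasure_subadditive) auto
      also have "\<dots> < r" using 0 xT by simp
      finally show False using M(4) by simp
    qed
    ultimately have "AE x in \<mu>. x \<notin> Q \<inter> T'" by (auto elim: eventually_mono)
    moreover have "Q \<inter> T' \<in> sets \<mu>" by simp
    ultimately have "Q \<inter> T' \<in> null_sets \<mu>" by (simp only: AE_iff_null_sets)
    then show ?thesis by auto
  qed
  have Tnull: "emeasure \<mu> (T r) = 0" for r
  proof (rule ccontr)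
    assume "emeasure \<mu> (T r) \<noteq> 0"
    then have "0 < emeasure \<mu> (T r)" by (simp add: zero_less_iff_neq_zero)
    from radon_less_compactE[OF \<mu> Tb this] obtain T'
      where T': "compact T'" "T' \<subseteq> T r" "0 < emeasure \<mu> T'" by blast
    \<comment> \<open>Each point of \<open>T'\<close> receives a compact neighbourhood
      \<open>Q\<close> over which one fixed compact \<open>M\<close> works. Compactness of
      \<open>T'\<close> then leaves finitely many sets \<open>Q \<inter> T'\<close>, each null by
      \<open>rect\<close>.\<close>
    have "\<exists>V Q M. open V \<and> x \<in> V \<and> V \<subseteq> Q \<and> compact Q \<and> compact M \<and> M \<subseteq> L \<and> Q \<times> M \<subseteq> G \<and> r < emeasure \<nu> M"
      if "x \<in> T'" for x
    proof -
      have "r < emeasure \<nu> (L \<inter> Pair x -` G)" using T' that by (auto simp: T_def b_def)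
      from radon_less_compactE[OF \<nu> _ this] obtain M
        where M: "compact M" "M \<subseteq> L \<inter> Pair x -` G" "r < emeasure \<nu> M"
        using Lb sets_Pair_vimage[OF Gb, of x] by blast
      have "{x} \<times> M \<subseteq> G" using M by auto
      from Elementary_Topology.tube_lemma[OF M(1) G this] obtain W
        where W: "x \<in> W" "open W" "W \<times> M \<subseteq> G" by blast
      from locally_compact_nbhdE[OF lc W(2,1)] obtain V Q
        where "open V" "compact Q" "x \<in> V" "V \<subseteq> Q" "Q \<subseteq> W" by blast
      with M W show ?thesis
        by (intro exI[of _ V] exI[of _ Q] exI[of _ M]) auto
    qed
    then obtain V Q M where VQ: "\<And>x. x \<in> T' \<Longrightarrow> open (V x) \<and> x \<in> V x \<and> V x \<subseteq> Q x \<and> compact (Q x)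
        \<and> compact (M x) \<and> M x \<subseteq> L \<and> Q x \<times> M x \<subseteq> G \<and> r < emeasure \<nu> (M x)"
      by metis
    obtain X where X: "X \<subseteq> T'" "finite X" "T' \<subseteq> (\<Union>x\<in>X. V x)"
      by (rule compactE_image[OF T'(1), of T' V]) (use VQ in auto)
    have Tsub: "T' \<subseteq> (\<Union>x\<in>X. Q x \<inter> T')"
    proof
      fix y assume y: "y \<in> T'"
      with X obtain x where "x \<in> X" "y \<in> V x" by blast
      with VQ[of x] X y show "y \<in> (\<Union>x\<in>X. Q x \<inter> T')" by blast
    qed
    have QT: "Q x \<inter> T' \<in> null_sets \<mu>" if "x \<in> X" for x
    proof -
      have V: "compact (Q x)" "compact (M x)" "M x \<subseteq> L" "Q x \<times> M x \<subseteq> G" "r < emeasure \<nu> (M x)"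
        using VQ[of x] X(1) that by auto
      show ?thesis
        using rect[OF T'(1,2) V] compact_borel[OF T'(1)] compact_borel[OF V(1)] by (simp add: null_sets_def sets.Int)
    qed
    then have N: "(\<Union>x\<in>X. Q x \<inter> T') \<in> null_sets \<mu>"
      using X(2) by (intro null_sets_UN') (auto intro: countable_finite)
    have "emeasure \<mu> T' = 0"
      by (rule emeasure_eq_0[OF null_setsD2[OF N] null_setsD1[OF N] Tsub])
    with T'(3) show False by simp
  qed
  have "AE x in \<mu>. \<forall>r\<in>D. x \<notin> T r"
  proof (subst AE_ball_countable[OF D(1)], intro ballI)
    fix r
    have "T r \<in> null_sets \<mu>" using Tnull Tb by (simp add: null_sets_def)
    then show "AE x in \<mu>. x \<notin> T r" by (rule AE_not_in)
  qed
  moreover have "emeasure \<nu> (L \<inter> Pair x -` (G - G')) * indicator K x = 0" if x: "\<forall>r\<in>D. x \<notin> T r" for x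
  proof (cases "x \<in> K")
    case True
    have "\<not> a x < b x"
    proof
      assume "a x < b x"
      then have "{a x<..<b x} \<noteq> {}" using dense by fastforce
      with D(2)[of "{a x<..<b x}"] x True show False by (auto simp: T_def)
    qed
    moreover have "L \<inter> Pair x -` (G - G') = (L \<inter> Pair x -` G) - (L \<inter> Pair x -` G')" by auto
    then have "emeasure \<nu> (L \<inter> Pair x -` (G - G')) = b x - a x"
      unfolding a_def b_def
      using Lb sets_Pair_vimage[OF Gb, of x] sets_Pair_vimage[OF G'b, of x] G'G finL[of "Pair x -` G'"]
      by (simp add: emeasure_Diff less_top) (subst emeasure_Diff; auto)
    moreover have "b x < \<infinity>" unfolding b_def by (rule finL)
    ultimately show ?thesis by (simp add: diff_eq_0_ennreal not_less)
  qed simp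
  ultimately have "AE x in \<mu>. emeasure \<nu> (L \<inter> Pair x -` (G - G')) * indicator K x = 0"
    by (auto elim: eventually_mono)
  then have null: "emeasure m (G - G') = 0"
    using Gb G'b sect[of "G - G'"] by (simp add: em nn_integral_0_iff_AE)
  \<comment> \<open>As \<open>m\<close> is finite, the null remainder \<open>G - G'\<close> is the
    limit of the remainders \<open>G - C n\<close>, and one of them falls below
    \<open>e\<close>.\<close>
  have "(INF n. emeasure m (G - C n)) = emeasure m (\<Inter>n. G - C n)"
    using C(1) finm Cb Gb by (intro INF_emeasure_decseq') (auto simp: decseq_def incseq_def less_top)
  also have "(\<Inter>n. G - C n) = G - G'" by (auto simp: G'_def)
  finally have "(INF n. emeasure m (G - C n)) < e" using null e by simp
  then obtain n where "emeasure m (G - C n) < e" by (auto simp: INF_less_iff)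
  with C(2)[of n] show ?thesis by (intro exI[of _ "C n"]) auto
qed

lemma section_measure_mono:
  fixes \<mu> :: "'a::t2_space measure" and \<nu> :: "'b::t2_space measure"
  assumes \<mu>: "radon \<mu>" and \<nu>: "radon \<nu>" and K: "compact K" "compact K'" "K \<subseteq> K'"
    and L: "compact L" "compact L'" "L \<subseteq> L'" and E: "E \<in> sets borel"
  shows "emeasure (section_measure \<mu> \<nu> K L) E \<le> emeasure (section_measure \<mu> \<nu> K' L') E"
  unfolding emeasure_section_measure[OF \<mu> \<nu> K(1) L(1) E] emeasure_section_measure[OF \<mu> \<nu> K(2) L(2) E]
proof (intro nn_integral_mono mult_mono)
  fix x
  show "emeasure \<nu> (L \<inter> Pair x -` E) \<le> emeasure \<nu> (L' \<inter> Pair x -` E)"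
    using L sets_Pair_vimage[OF E, of x] radon_sets[OF \<nu>] compact_borel[OF L(2)]
    by (intro emeasure_mono) auto
  show "indicator K x \<le> (indicator K' x :: ennreal)" using K by (auto simp: indicator_def)
qed auto

text \<open>Approximation of open sets extends to all Borel sets because the total mass
  \<open>emeasure \<nu> L * emeasure \<mu> K\<close> is finite.\<close>

lemma section_measure_inner:
  fixes \<mu> :: "'a::t2_space measure" and \<nu> :: "'b::t2_space measure"
  assumes lc: "locally_compact_space (euclidean :: 'a topology)"
    and \<mu>: "radon \<mu>" and \<nu>: "radon \<nu>" and K: "compact K" and L: "compact L"
    and B: "B \<in> sets borel"
  defines "m \<equiv> section_measure \<mu> \<nu> K L"
  assumes c: "c < emeasure m B"
  shows "\<exists>C. compact C \<and> C \<subseteq> B \<and> c \<le> emeasure m C"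
proof -
  have [simp]: "sets m = sets borel" by (simp add: m_def)
  have [simp]: "space m = UNIV" using sets_eq_imp_space_eq[of m borel] by simp
  have Kb: "K \<in> sets \<mu>" using compact_borel[OF K] radon_sets[OF \<mu>] by simp
  have "emeasure m UNIV = emeasure \<nu> L * emeasure \<mu> K"
    unfolding m_def emeasure_section_measure[OF \<mu> \<nu> K L borel_open[OF open_UNIV]]
    using Kb by (simp add: nn_integral_cmult)
  also have "\<dots> < \<infinity>"
    using radon_compact_finite[OF \<mu> K] radon_compact_finite[OF \<nu> L] by (simp add: ennreal_mult_less_top)
  finally have fin: "emeasure m UNIV < \<infinity>" .
  have finB: "emeasure m B < \<infinity>"
    by (rule le_less_trans[OF emeasure_mono fin]) simp_all
  have "0 < emeasure m B - c" using c by (rule diff_gr0_ennreal)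
  then have "\<exists>C. compact C \<and> C \<subseteq> B \<and> emeasure m (B - C) \<le> emeasure m B - c"
    using section_measure_open_regular[OF lc \<mu> \<nu> K L]
    by (intro finite_inner_regular_if_open[OF _ fin _ B]) (simp_all only: m_def sets_section_measure)
  then obtain C where C: "compact C" "C \<subseteq> B" "emeasure m (B - C) \<le> emeasure m B - c" by blast
  have "emeasure m B = emeasure m C + emeasure m (B - C)"
    using C B compact_borel[OF C(1)] by (subst plus_emeasure) (simp_all add: Un_absorb1 sets.Diff)
  then have "emeasure m B \<le> emeasure m C + (emeasure m B - c)"
    using C(3) by (metis add_left_mono)
  from ennreal_le_if_le_add_diff[OF this c finB] C show ?thesis by blast
qed

lemma compact_subset_rect:
  fixes C :: "('a::topological_space \<times> 'b::topological_space) set"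
  assumes "compact C"
  obtains K L where "compact K" "compact L" "C \<subseteq> K \<times> L"
proof
  show "compact (fst ` C)" "compact (snd ` C)"
    using assms by (auto intro!: compact_continuous_image continuous_intros)
  show "C \<subseteq> fst ` C \<times> snd ` C" by force
qed

text \<open>The product is the supremum of the section measures over all compact rectangles. Inner
  regularity survives this supremum, because a value below it is already exceeded on a single
  rectangle.\<close>

lemma radon_product_exists:
  fixes \<mu> :: "'a::t2_space measure" and \<nu> :: "'b::t2_space measure"
  assumes lc: "locally_compact_space (euclidean :: 'a topology)"
    and \<mu>: "radon \<mu>" and \<nu>: "radon \<nu>"
  shows "\<exists>\<rho>. radon \<rho> \<and> (\<forall>K L. compact K \<longrightarrow> compact L \<longrightarrow> emeasure \<rho> (K \<times> L) = emeasure \<mu> K * emeasure \<nu> L)"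
proof -
  let ?P = "{(K :: 'a set, L :: 'b set). compact K \<and> compact L}"
  define m where "m = (\<lambda>(K, L). section_measure \<mu> \<nu> K L)"
  define \<rho> where "\<rho> = measure_of UNIV (sets borel) (\<lambda>E. SUP p\<in>?P. emeasure (m p) E)"
  have [simp]: "sets (m p) = sets borel" for p by (simp add: m_def split: prod.splits)
  have [simp]: "sets \<rho> = sets borel"
    unfolding \<rho>_def using sets.sets_measure_of_eq[of borel] by simp
  \<comment> \<open>Directedness allows the supremum to be exchanged with the countable sum; for an
    arbitrary family a supremum of measures need not be additive.\<close>
  have dir: "\<exists>r\<in>?P. \<forall>E\<in>sets borel. emeasure (m p) E \<le> emeasure (m r) E \<and> emeasure (m q) E \<le> emeasure (m r) E"
    if p: "p \<in> ?P" and q: "q \<in> ?P" for p q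
  proof -
    obtain K L K' L' where pq: "p = (K, L)" "q = (K', L')" by (cases p; cases q) blast
    show ?thesis
      using p q unfolding pq m_def
      by (intro bexI[of _ "(K \<union> K', L \<union> L')"])
         (auto intro!: section_measure_mono[OF \<mu> \<nu>] compact_Un)
  qed
  have em: "emeasure \<rho> E = (SUP p\<in>?P. emeasure (m p) E)" if E: "E \<in> sets borel" for E
    unfolding \<rho>_def
  proof (rule emeasure_measure_of_sigma[OF _ _ _ E])
    show "sigma_algebra UNIV (sets (borel :: ('a \<times> 'b) measure))"
      using sets.sigma_algebra_axioms[of "borel :: ('a \<times> 'b) measure"] by simp
    show "positive (sets borel) (\<lambda>E. SUP p\<in>?P. emeasure (m p) E)" 
      unfolding positive_def emeasure_empty by (intro antisym SUP_least) simp_all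
    show "countably_additive (sets borel) (\<lambda>E. SUP p\<in>?P. emeasure (m p) E)"
    proof (rule countably_additiveI)
      fix A :: "nat \<Rightarrow> ('a \<times> 'b) set" assume A: "range A \<subseteq> sets borel" "disjoint_family A"
      have "(\<Sum>i. SUP p\<in>?P. emeasure (m p) (A i)) = (SUP p\<in>?P. \<Sum>i. emeasure (m p) (A i))"
      proof (rule ennreal_suminf_SUP_eq_directed)
        fix N p q assume "p \<in> ?P" "q \<in> ?P"
        from dir[OF this] A(1)
        show "\<exists>r\<in>?P. \<forall>n\<in>N. emeasure (m p) (A n) \<le> emeasure (m r) (A n) \<and> emeasure (m q) (A n) \<le> emeasure (m r) (A n)"
          by (meson rangeI subsetD)
      qed
      also have "\<dots> = (SUP p\<in>?P. emeasure (m p) (\<Union>i. A i))"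
        using A by (simp add: suminf_emeasure)
      finally show "(\<Sum>i. SUP p\<in>?P. emeasure (m p) (A i)) = (SUP p\<in>?P. emeasure (m p) (\<Union>i. A i))" .
    qed
  qed
  have rect: "emeasure \<rho> (K \<times> L) = emeasure \<mu> K * emeasure \<nu> L" if KL: "compact K" "compact L" for K L
  proof -
    have b: "K \<times> L \<in> sets borel" using KL by (simp add: compact_borel compact_Times)
    have Kb: "K \<in> sets \<mu>" using compact_borel[OF KL(1)] radon_sets[OF \<mu>] by simp
    have Lb: "L \<in> sets \<nu>" using compact_borel[OF KL(2)] radon_sets[OF \<nu>] by simp
    have int: "(\<integral>\<^sup>+x. emeasure \<nu> L * indicator K x \<partial>\<mu>) = emeasure \<mu> K * emeasure \<nu> L"
      using Kb mult.commute[of "emeasure \<nu> L" "emeasure \<mu> K"] by (simp add: nn_integral_cmult)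
    show ?thesis
      unfolding em[OF b]
    proof (rule antisym)
      show "(SUP p\<in>?P. emeasure (m p) (K \<times> L)) \<le> emeasure \<mu> K * emeasure \<nu> L"
      proof (rule SUP_least, clarify)
        fix K' :: "'a set" and L' :: "'b set" assume KL': "compact K'" "compact L'"
        have "emeasure (m (K', L')) (K \<times> L) \<le> (\<integral>\<^sup>+x. emeasure \<nu> L * indicator K x \<partial>\<mu>)"
          unfolding m_def prod.case emeasure_section_measure[OF \<mu> \<nu> KL' b]
        proof (rule nn_integral_mono)
          fix x
          have "emeasure \<nu> (L' \<inter> Pair x -` (K \<times> L)) \<le> emeasure \<nu> L * indicator K x"
            using Lb by (cases "x \<in> K") (auto intro!: emeasure_mono)
          then show "emeasure \<nu> (L' \<inter> Pair x -` (K \<times> L)) * indicator K' x \<le> emeasure \<nu> L * indicator K x"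
            by (cases "x \<in> K'") auto
        qed
        then show "emeasure (m (K', L')) (K \<times> L) \<le> emeasure \<mu> K * emeasure \<nu> L" using int by simp
      qed
      have "emeasure \<mu> K * emeasure \<nu> L = emeasure (m (K, L)) (K \<times> L)"
        unfolding m_def prod.case emeasure_section_measure[OF \<mu> \<nu> KL b] int[symmetric]
        by (intro nn_integral_cong) (auto simp: indicator_def vimage_def)
      also have "\<dots> \<le> (SUP p\<in>?P. emeasure (m p) (K \<times> L))"
        using KL by (intro SUP_upper) auto
      finally show "emeasure \<mu> K * emeasure \<nu> L \<le> (SUP p\<in>?P. emeasure (m p) (K \<times> L))" .
    qed
  qed
  have "radon \<rho>"
  proof (rule radonI)
    fix C :: "('a \<times> 'b) set" assume "compact C"
    from compact_subset_rect[OF this] obtain K L where KL: "compact K" "compact L" "C \<subseteq> K \<times> L" .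
    have "emeasure \<rho> C \<le> emeasure \<rho> (K \<times> L)"
      using KL by (intro emeasure_mono) (simp_all add: compact_borel compact_Times)
    also have "\<dots> < \<infinity>"
      using radon_compact_finite[OF \<mu> KL(1)] radon_compact_finite[OF \<nu> KL(2)]
      by (simp add: rect KL ennreal_mult_less_top)
    finally show "emeasure \<rho> C < \<infinity>" .
  next
    fix B c assume B: "B \<in> sets borel" and "c < emeasure \<rho> B"
    then obtain K L where KL: "compact K" "compact L" "c < emeasure (section_measure \<mu> \<nu> K L) B"
      by (auto simp: em less_SUP_iff m_def)
    from section_measure_inner[OF lc \<mu> \<nu> KL(1,2) B KL(3)] obtain C
      where C: "compact C" "C \<subseteq> B" "c \<le> emeasure (m (K, L)) C" by (auto simp: m_def)
    have "emeasure (m (K, L)) C \<le> emeasure \<rho> C"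
      unfolding em[OF compact_borel[OF C(1)]] using KL by (intro SUP_upper) auto
    with C show "\<exists>K. compact K \<and> K \<subseteq> B \<and> c \<le> emeasure \<rho> K" by (meson order_trans)
  qed simp
  with rect show ?thesis by blast
qed

text \<open>The sigma-algebra generated by the compact rectangles in \<open>K \<times> L\<close> may
  miss \<open>C\<close> itself. It contains, however, a finite union \<open>R\<close> of rectangles
  with \<open>C \<subseteq> R\<close> whose excess over \<open>C\<close> has small
  \<open>\<rho>'\<close>-measure, and the two measures agree on \<open>R\<close>. The hypotheses are
  symmetric, so one inequality gives equality.\<close>

lemma radon_le_if_eq_rect:
  fixes \<rho> \<rho>' :: "('a::t2_space \<times> 'b::t2_space) measure"
  assumes lca: "locally_compact_space (euclidean :: 'a topology)"
    and lcb: "locally_compact_space (euclidean :: 'b topology)"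
    and \<rho>: "radon \<rho>" and \<rho>': "radon \<rho>'"
    and eq: "\<And>K L. compact K \<Longrightarrow> compact L \<Longrightarrow> emeasure \<rho> (K \<times> L) = emeasure \<rho>' (K \<times> L)"
    and C: "compact C"
  shows "emeasure \<rho> C \<le> emeasure \<rho>' C"
proof (rule ennreal_le_epsilon)
  fix e :: real assume e: "0 < e"
  note [simp] = radon_sets[OF \<rho>] radon_sets[OF \<rho>']
  obtain K L where KL: "compact K" "compact L" "C \<subseteq> K \<times> L"
    using compact_subset_rect[OF C] .
  let ?\<Omega> = "K \<times> L"
  let ?R = "{A \<times> B | A B. compact A \<and> compact B \<and> A \<subseteq> K \<and> B \<subseteq> L}"
  have \<Omega>: "compact ?\<Omega>" using KL by (simp add: compact_Times)
  have \<Omega>b: "?\<Omega> \<in> sets borel" using \<Omega> by (rule compact_borel)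
  have Cb: "C \<in> sets borel" using C by (rule compact_borel)
  have pow: "?R \<subseteq> Pow ?\<Omega>" by auto
  interpret R: sigma_algebra ?\<Omega> "sigma_sets ?\<Omega> ?R" using pow by (rule sigma_algebra_sigma_sets)
  have stable: "Int_stable ?R"
  proof (rule Int_stableI)
    fix a b assume "a \<in> ?R" "b \<in> ?R"
    then obtain A B A' B' where "a = A \<times> B" "b = A' \<times> B'"
      "compact A" "compact B" "A \<subseteq> K" "B \<subseteq> L" "compact A'" "compact B'" by blast
    then show "a \<inter> b \<in> ?R"
      by (simp, intro exI[of _ "A \<inter> A'"] exI[of _ "B \<inter> B'"])
         (auto intro: compact_Int_closed compact_imp_closed)
  qed
  have same: "R \<in> sets borel \<and> emeasure \<rho> R = emeasure \<rho>' R" if "R \<in> sigma_sets ?\<Omega> ?R" for R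
    using stable pow that
  proof (induction rule: sigma_sets_induct_disjoint)
    case (basic A)
    then show ?case using eq by (auto intro!: compact_borel compact_Times)
  next
    case (compl A)
    have "A \<subseteq> ?\<Omega>" using compl(1) R.sets_into_space by blast
    have "emeasure \<rho> A < \<infinity>"
      by (rule le_less_trans[OF emeasure_mono radon_compact_finite[OF \<rho> \<Omega>]]) (simp_all add: \<open>A \<subseteq> _\<close> \<Omega>b)
    moreover have "emeasure \<rho>' A < \<infinity>"
      by (rule le_less_trans[OF emeasure_mono radon_compact_finite[OF \<rho>' \<Omega>]]) (simp_all add: \<open>A \<subseteq> _\<close> \<Omega>b)
    ultimately show ?case
      using compl \<open>A \<subseteq> _\<close> \<Omega>b eq[OF KL(1,2)] by (simp add: emeasure_Diff less_top sets.Diff)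
  next
    case (union A)
    then have "range A \<subseteq> sets borel" by auto
    then have "emeasure \<rho> (\<Union>i. A i) = emeasure \<rho>' (\<Union>i. A i)"
      using union suminf_emeasure[of A \<rho>] suminf_emeasure[of A \<rho>'] by simp
    then show ?case using \<open>range A \<subseteq> sets borel\<close> by auto
  qed simp
  \<comment> \<open>Regularity from outside comes from regularity from inside applied to the
    complement in \<open>?\<Omega>\<close>: a set around \<open>C\<close> that avoids
    \<open>D\<close> can exceed \<open>C\<close> within \<open>?\<Omega>\<close> only by mass
    \<open>e\<close>.\<close>
  have "emeasure \<rho>' (?\<Omega> - C) < \<infinity>"
    by (rule le_less_trans[OF emeasure_mono radon_compact_finite[OF \<rho>' \<Omega>]]) (simp_all add: \<Omega>b Diff_subset)
  then obtain D where D: "compact D" "D \<subseteq> ?\<Omega> - C" "emeasure \<rho>' (?\<Omega> - C - D) \<le> ennreal e"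
    using radon_approx[OF \<rho>', of "?\<Omega> - C" "ennreal e"] \<Omega>b Cb e by (auto simp: sets.Diff)
  have oD: "open (- D)" using compact_imp_closed[OF D(1)] by (rule open_Compl)
  \<comment> \<open>The open boxes \<open>S\<close> serve to cover \<open>C\<close>; the compact
    boxes \<open>Q \<times> Q'\<close> around them are needed because \<open>R\<close> must be
    assembled from the generators in \<open>?R\<close>. Local compactness of both factors provides
    them.\<close>
  have "\<exists>S V V' Q Q'. open S \<and> S = V \<times> V' \<and> z \<in> S \<and> V \<subseteq> Q \<and> V' \<subseteq> Q' \<and> compact Q \<and> compact Q' \<and> Q \<times> Q' \<subseteq> - D"
    if "z \<in> C" for z
  proof -
    have "z \<in> - D" using that D by auto
    then obtain U U' where U: "open U" "open U'" "z \<in> U \<times> U'" "U \<times> U' \<subseteq> - D"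
      using oD by (auto elim: open_prod_elim)
    then have z: "fst z \<in> U" "snd z \<in> U'" by auto
    from locally_compact_nbhdE[OF lca U(1) z(1)] obtain V Q
      where V: "open V" "compact Q" "fst z \<in> V" "V \<subseteq> Q" "Q \<subseteq> U" .
    from locally_compact_nbhdE[OF lcb U(2) z(2)] obtain V' Q'
      where V': "open V'" "compact Q'" "snd z \<in> V'" "V' \<subseteq> Q'" "Q' \<subseteq> U'" .
    have "open (V \<times> V')" "z \<in> V \<times> V'"
      using V V' by (simp_all add: open_Times mem_Times_iff)
    moreover have "Q \<times> Q' \<subseteq> - D"
      using V(5) V'(5) by (intro order_trans[OF Sigma_mono U(4)])
    ultimately show ?thesis using V V' by blast
  qed
  then obtain S V V' Q Q' where S: "\<And>z. z \<in> C \<Longrightarrow> open (S z) \<and> S z = V z \<times> V' z \<and> z \<in> S z \<and> V z \<subseteq> Q z \<and> V' z \<subseteq> Q' z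
      \<and> compact (Q z) \<and> compact (Q' z) \<and> Q z \<times> Q' z \<subseteq> - D"
    by metis
  have oS: "\<And>z. z \<in> C \<Longrightarrow> open (S z)" and cS: "C \<subseteq> (\<Union>z\<in>C. S z)"
    using S by blast+
  obtain X where X: "X \<subseteq> C" "finite X" "C \<subseteq> (\<Union>z\<in>X. S z)"
    by (rule compactE_image[OF C oS cS])
  define R where "R = (\<Union>z\<in>X. (Q z \<inter> K) \<times> (Q' z \<inter> L))"
  have "(Q z \<inter> K) \<times> (Q' z \<inter> L) \<in> ?R" if "z \<in> X" for z
  proof -
    have "compact (Q z)" "compact (Q' z)" using S[of z] X(1) that by auto
    then have "compact (Q z \<inter> K)" "compact (Q' z \<inter> L)" using KL by (auto intro: compact_Int)
    then show ?thesis by blast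
  qed
  then have "R \<in> sigma_sets ?\<Omega> ?R"
    unfolding R_def using X(2) by (intro R.finite_UN) (auto intro: sigma_sets.Basic)
  from same[OF this] have Rb: "R \<in> sets borel" and Req: "emeasure \<rho> R = emeasure \<rho>' R" by auto
  have CR: "C \<subseteq> R"
  proof
    fix y assume y: "y \<in> C"
    with X obtain z where z: "z \<in> X" "y \<in> S z" by blast
    have "S z = V z \<times> V' z" "V z \<subseteq> Q z" "V' z \<subseteq> Q' z" using S[of z] X(1) z(1) by auto
    with z(2) have "y \<in> Q z \<times> Q' z" by auto
    moreover have "y \<in> K \<times> L" using KL(3) y by auto
    ultimately show "y \<in> R" unfolding R_def using z(1) by (auto intro!: bexI[of _ z])
  qed
  have RD: "R \<subseteq> C \<union> (?\<Omega> - C - D)"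
  proof
    fix y assume "y \<in> R"
    then obtain z where z: "z \<in> X" "y \<in> (Q z \<inter> K) \<times> (Q' z \<inter> L)" by (auto simp: R_def)
    then have "y \<in> - D" using S[of z] X(1) by blast
    with z show "y \<in> C \<union> (?\<Omega> - C - D)" by auto
  qed
  have Eb: "?\<Omega> - C - D \<in> sets borel" using \<Omega>b Cb compact_borel[OF D(1)] by (intro sets.Diff)
  have "emeasure \<rho> C \<le> emeasure \<rho>' R" unfolding Req[symmetric] using CR Rb by (intro emeasure_mono) simp_all
  also have "\<dots> \<le> emeasure \<rho>' (C \<union> (?\<Omega> - C - D))" using RD Cb Eb by (intro emeasure_mono) simp_all
  also have "\<dots> \<le> emeasure \<rho>' C + emeasure \<rho>' (?\<Omega> - C - D)" using Cb Eb by (intro emeasure_subadditive) simp_all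
  also have "\<dots> \<le> emeasure \<rho>' C + ennreal e" using D(3) by (rule add_left_mono)
  finally show "emeasure \<rho> C \<le> emeasure \<rho>' C + ennreal e" .
qed

lemma radon_prod_eqI:
  fixes \<mu> :: "'a::t2_space measure" and \<nu> :: "'b::t2_space measure"
  assumes "locally_compact_space (euclidean :: 'a topology)" "locally_compact_space (euclidean :: 'b topology)"
    and "radon \<rho>"
    and "\<And>K L. compact K \<Longrightarrow> compact L \<Longrightarrow> emeasure \<rho> (K \<times> L) = emeasure \<mu> K * emeasure \<nu> L"
  shows "radon_prod \<mu> \<nu> = \<rho>"
  unfolding radon_prod_def
proof (rule the_equality)
  fix \<rho>' assume "radon \<rho>' \<and> (\<forall>K L. compact K \<longrightarrow> compact L \<longrightarrow> emeasure \<rho>' (K \<times> L) = emeasure \<mu> K * emeasure \<nu> L)"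
  then have \<rho>': "radon \<rho>'"
      "\<And>K L. compact K \<Longrightarrow> compact L \<Longrightarrow> emeasure \<rho>' (K \<times> L) = emeasure \<rho> (K \<times> L)"
    using assms(4) by auto
  show "\<rho>' = \<rho>"
  proof (rule radon_eqI[OF \<rho>'(1) assms(3)], rule antisym)
    fix C :: "('a \<times> 'b) set" assume C: "compact C"
    show "emeasure \<rho>' C \<le> emeasure \<rho> C"
      by (rule radon_le_if_eq_rect[OF assms(1,2) \<rho>'(1) assms(3) \<rho>'(2) C])
    show "emeasure \<rho> C \<le> emeasure \<rho>' C"
      by (rule radon_le_if_eq_rect[OF assms(1,2) assms(3) \<rho>'(1) \<rho>'(2)[symmetric] C])
  qed
qed (use assms in auto)

lemma
  fixes \<mu> :: "'a::t2_space measure" and \<nu> :: "'b::t2_space measure"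
  assumes lc: "locally_compact_space (euclidean :: 'a topology)" "locally_compact_space (euclidean :: 'b topology)"
    and \<mu>: "radon \<mu>" and \<nu>: "radon \<nu>"
  shows radon_radon_prod: "radon (radon_prod \<mu> \<nu>)"
    and emeasure_radon_prod: "compact K \<Longrightarrow> compact L \<Longrightarrow>
      emeasure (radon_prod \<mu> \<nu>) (K \<times> L) = emeasure \<mu> K * emeasure \<nu> L"
proof -
  obtain \<rho> where \<rho>: "radon \<rho>"
      "\<And>K L. compact K \<Longrightarrow> compact L \<Longrightarrow> emeasure \<rho> (K \<times> L) = emeasure \<mu> K * emeasure \<nu> L"
    using radon_product_exists[OF lc(1) \<mu> \<nu>] by blast
  have eq: "radon_prod \<mu> \<nu> = \<rho>" by (rule radon_prod_eqI[OF lc \<rho>])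
  show "radon (radon_prod \<mu> \<nu>)"
    and "compact K \<Longrightarrow> compact L \<Longrightarrow> emeasure (radon_prod \<mu> \<nu>) (K \<times> L) = emeasure \<mu> K * emeasure \<nu> L"
    unfolding eq by (fact \<rho>)+
qed

text \<open>Both sides are Radon and agree on compact rectangles by distributivity, and these
  determine the product.\<close>

lemma radon_prod_add_left:
  fixes \<mu> \<mu>' :: "'a::t2_space measure" and \<nu> :: "'b::t2_space measure"
  assumes lc: "locally_compact_space (euclidean :: 'a topology)" "locally_compact_space (euclidean :: 'b topology)"
    and \<mu>: "radon \<mu>" and \<mu>': "radon \<mu>'" and \<nu>: "radon \<nu>"
  shows "radon_prod (add_measure \<mu> \<mu>') \<nu> = add_measure (radon_prod \<mu> \<nu>) (radon_prod \<mu>' \<nu>)"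
  by (rule radon_prod_eqI[OF lc])
     (simp_all add: radon_add_measure radon_radon_prod emeasure_radon_prod emeasure_add_measure radon_sets distrib_right lc \<mu> \<mu>' \<nu>)

lemma radon_prod_add_right:
  fixes \<mu> :: "'a::t2_space measure" and \<nu> \<nu>' :: "'b::t2_space measure"
  assumes lc: "locally_compact_space (euclidean :: 'a topology)" "locally_compact_space (euclidean :: 'b topology)"
    and \<mu>: "radon \<mu>" and \<nu>: "radon \<nu>" and \<nu>': "radon \<nu>'"
  shows "radon_prod \<mu> (add_measure \<nu> \<nu>') = add_measure (radon_prod \<mu> \<nu>) (radon_prod \<mu> \<nu>')"
  by (rule radon_prod_eqI[OF lc])
     (simp_all add: radon_add_measure radon_radon_prod emeasure_radon_prod emeasure_add_measure radon_sets distrib_left lc \<mu> \<nu> \<nu>')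

section \<open>Jordan decomposition of a difference\<close>

lemma signed_radon_swap: "signed_radon (\<alpha>, \<beta>) \<longleftrightarrow> signed_radon (\<beta>, \<alpha>)"
  by (auto simp: signed_radon_def)

text \<open>Lattice infimum 0 amounts to mutual singularity on each compact set. A Hahn
  decomposition of \<open>K\<close> exhibits the infimum on \<open>K\<close>, and its vanishing is
  the separation.\<close>

lemma signed_radon_separated:
  fixes \<alpha> \<beta> :: "'a::t2_space measure"
  assumes s: "signed_radon (\<alpha>, \<beta>)" and K: "compact K"
  obtains Y where "Y \<in> sets borel" "Y \<subseteq> K" "emeasure \<beta> Y = 0" "emeasure \<alpha> (K - Y) = 0"
proof -
  have r: "radon \<alpha>" "radon \<beta>" using s by (auto simp: signed_radon_def)
  note [simp] = radon_sets[OF r(1)] radon_sets[OF r(2)]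
  have Kb: "K \<in> sets borel" using K by (rule compact_borel)
  have "emeasure \<alpha> K \<noteq> top" "emeasure \<beta> K \<noteq> top"
    using radon_compact_finite[OF r(1) K] radon_compact_finite[OF r(2) K] by auto
  with unsigned_Hahn_decomposition[of \<beta> \<alpha> K] Kb
  obtain Y where Y: "Y \<in> sets borel" "Y \<subseteq> K" "\<And>X. X \<in> sets borel \<Longrightarrow> X \<subseteq> Y \<Longrightarrow> emeasure \<beta> X \<le> emeasure \<alpha> X"
     "\<And>X. X \<in> sets borel \<Longrightarrow> X \<subseteq> K \<Longrightarrow> X \<inter> Y = {} \<Longrightarrow> emeasure \<alpha> X \<le> emeasure \<beta> X"
    by auto
  \<comment> \<open>On \<open>K\<close> this is the smaller of the two measures on either part:
    \<open>\<alpha>\<close> on \<open>K - Y\<close>, \<open>\<beta>\<close> on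
    \<open>Y\<close>.\<close>
  define \<rho> where "\<rho> = add_measure (density \<alpha> (indicator (K - Y))) (density \<beta> (indicator Y))"
  have em: "emeasure \<rho> B = emeasure \<alpha> ((K - Y) \<inter> B) + emeasure \<beta> (Y \<inter> B)" if "B \<in> sets borel" for B
    unfolding \<rho>_def using that Y Kb by (simp add: emeasure_add_measure emeasure_restricted sets.Diff)
  have split: "emeasure \<mu> ((K - Y) \<inter> B) + emeasure \<mu> (Y \<inter> B) \<le> emeasure \<mu> B"
    if "B \<in> sets borel" "radon \<mu>" for B and \<mu> :: "'a measure"
    using that Y Kb radon_sets[OF that(2)]
    by (subst plus_emeasure) (auto intro!: emeasure_mono)
  have le\<alpha>: "emeasure \<rho> B \<le> emeasure \<alpha> B" if B: "B \<in> sets borel" for B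
    using Y B Kb by (subst em) (auto intro!: order_trans[OF add_left_mono split[OF B r(1)]])
  have le\<beta>: "emeasure \<rho> B \<le> emeasure \<beta> B" if B: "B \<in> sets borel" for B
  proof -
    have "emeasure \<alpha> ((K - Y) \<inter> B) \<le> emeasure \<beta> ((K - Y) \<inter> B)"
      by (rule Y(4)) (use Y(1) Kb B in \<open>simp add: sets.Diff sets.Int\<close>, blast+)
    then show ?thesis unfolding em[OF B] by (rule order_trans[OF add_right_mono split[OF B r(2)]])
  qed
  have "radon \<rho>"
  proof (rule radon_le[OF r(1), where A = "\<lambda>_. K"])
    have "(K - Y) \<inter> - K = {}" "Y \<inter> - K = {}" using Y(2) by blast+
    then show "emeasure \<rho> (- (\<Union>n::nat. K)) = 0" using Kb em[of "- K"] by simp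
  qed (use le\<alpha> Kb radon_compact_finite[OF r(1) K] in \<open>simp_all add: \<rho>_def\<close>)
  with s le\<alpha> le\<beta> have "emeasure \<rho> UNIV = 0" by (auto simp: signed_radon_def measure_le_def)
  then show ?thesis using Y by (intro that[of Y]) (auto simp: em)
qed

text \<open>Minimality of the Jordan decomposition: \<open>\<alpha>\<close> restricted to
  \<open>K\<close> is carried by a set \<open>Y\<close> on which \<open>\<beta>\<close> vanishes,
  and there the identity reads \<open>\<alpha> + \<beta>' = \<alpha>'\<close>.\<close>

lemma jordan_parts_le:
  fixes \<alpha> \<beta> \<alpha>' \<beta>' :: "'a::t2_space measure"
  assumes s: "signed_radon (\<alpha>, \<beta>)" and s': "signed_radon (\<alpha>', \<beta>')" and K: "compact K"
    and eq: "\<And>B. B \<in> sets borel \<Longrightarrow> B \<subseteq> K \<Longrightarrow> emeasure \<alpha> B + emeasure \<beta>' B = emeasure \<alpha>' B + emeasure \<beta> B"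
  shows "emeasure \<alpha> K \<le> emeasure \<alpha>' K"
proof -
  have r: "radon \<alpha>" "radon \<alpha>'" using s s' by (auto simp: signed_radon_def)
  note [simp] = radon_sets[OF r(1)] radon_sets[OF r(2)]
  obtain Y where Y: "Y \<in> sets borel" "Y \<subseteq> K" "emeasure \<beta> Y = 0" "emeasure \<alpha> (K - Y) = 0"
    using signed_radon_separated[OF s K] .
  have "emeasure \<alpha> K = emeasure \<alpha> Y + emeasure \<alpha> (K - Y)"
    using Y compact_borel[OF K] by (subst plus_emeasure) (auto simp: Un_absorb1)
  also have "\<dots> \<le> emeasure \<alpha> Y + emeasure \<beta>' Y" using Y by simp
  also have "\<dots> = emeasure \<alpha>' Y" using eq Y by simp
  also have "\<dots> \<le> emeasure \<alpha>' K" using Y compact_borel[OF K] by (intro emeasure_mono) auto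
  finally show ?thesis .
qed

text \<open>Two representations \<open>a - b\<close> and \<open>a' - b'\<close> of the same
  \<open>p - n\<close> are compared without subtraction. Cancellation needs \<open>p\<close> and
  \<open>n\<close> finite, which is why it is applied to subsets of compact sets only.\<close>

lemma ennreal_cross_cancel:
  fixes p n a b a' b' :: ennreal
  assumes "p + b = n + a" "p + b' = n + a'" "p < \<infinity>" "n < \<infinity>"
  shows "a + b' = a' + b"
proof -
  have "(p + n) + (a + b') = (p + b') + (n + a)" by (simp add: ac_simps)
  also have "\<dots> = (n + a') + (p + b)" using assms by simp
  also have "\<dots> = (p + n) + (a' + b)" by (simp add: ac_simps)
  finally show ?thesis using assms by (subst (asm) ennreal_add_left_cancel) auto
qed

lemma radon_diff_eqI:
  fixes P N \<alpha> \<beta> :: "'a::t2_space measure"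
  assumes P: "radon P" and N: "radon N" and s: "signed_radon (\<alpha>, \<beta>)"
    and eq: "\<And>B. B \<in> sets borel \<Longrightarrow> emeasure P B + emeasure \<beta> B = emeasure N B + emeasure \<alpha> B"
  shows "radon_diff P N = (\<alpha>, \<beta>)"
  unfolding radon_diff_def
proof (rule the_equality)
  fix \<nu> assume \<nu>: "signed_radon \<nu> \<and> (\<forall>B\<in>sets borel. emeasure P B + emeasure (snd \<nu>) B = emeasure N B + emeasure (fst \<nu>) B)"
  obtain \<alpha>' \<beta>' where n: "\<nu> = (\<alpha>', \<beta>')" by (cases \<nu>)
  have s': "signed_radon (\<alpha>', \<beta>')" using \<nu> n by simp
  have r: "radon \<alpha>" "radon \<beta>" "radon \<alpha>'" "radon \<beta>'" using s s' by (auto simp: signed_radon_def)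
  have cross: "emeasure \<alpha> B + emeasure \<beta>' B = emeasure \<alpha>' B + emeasure \<beta> B"
    if B: "B \<in> sets borel" "B \<subseteq> K" and K: "compact K" for B K
  proof (rule ennreal_cross_cancel[of "emeasure P B" _ "emeasure N B"])
    show "emeasure P B < \<infinity>"
      by (rule le_less_trans[OF emeasure_mono radon_compact_finite[OF P K]])
         (simp_all add: radon_sets[OF P] compact_borel[OF K] B)
    show "emeasure N B < \<infinity>"
      by (rule le_less_trans[OF emeasure_mono radon_compact_finite[OF N K]])
         (simp_all add: radon_sets[OF N] compact_borel[OF K] B)
  qed (use eq \<nu> n B in auto)
  have "\<alpha> = \<alpha>'"
  proof (rule radon_eqI[OF r(1,3)], rule antisym)
    fix K :: "'a set" assume K: "compact K"
    show "emeasure \<alpha> K \<le> emeasure \<alpha>' K"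
      by (rule jordan_parts_le[OF s s' K]) (rule cross[OF _ _ K])
    show "emeasure \<alpha>' K \<le> emeasure \<alpha> K"
      by (rule jordan_parts_le[OF s' s K]) (rule cross[OF _ _ K, symmetric])
  qed
  moreover have "\<beta> = \<beta>'"
  proof (rule radon_eqI[OF r(2,4)], rule antisym)
    fix K :: "'a set" assume K: "compact K"
    \<comment> \<open>Swapping the components represents the negatives of the signed measures, so
      the same minimality argument applies to the negative parts.\<close>
    have t: "signed_radon (\<beta>, \<alpha>)" "signed_radon (\<beta>', \<alpha>')" using s s' signed_radon_swap by blast+
    show "emeasure \<beta> K \<le> emeasure \<beta>' K"
      by (rule jordan_parts_le[OF t K]) (metis add.commute cross[OF _ _ K])
    show "emeasure \<beta>' K \<le> emeasure \<beta> K"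
      by (rule jordan_parts_le[OF t(2,1) K]) (metis add.commute cross[OF _ _ K])
  qed
  ultimately show "\<nu> = (\<alpha>, \<beta>)" by (simp add: n)
qed (use assms in auto)

text \<open>Exhausting sequences for the two measures are intersected term by term; since both
  increase, the intersections still cover the space.\<close>

lemma sigma_finite_add_measure:
  assumes "sigma_finite_measure M" "sigma_finite_measure N" and [simp]: "sets N = sets M"
  shows "sigma_finite_measure (add_measure M N)"
proof -
  have sp: "space N = space M" using assms(3) by (rule sets_eq_imp_space_eq)
  from sigma_finite_measure.sigma_finite_incseq[OF assms(1)] obtain A :: "nat \<Rightarrow> _"
    where A: "range A \<subseteq> sets M" "(\<Union>i. A i) = space M" "\<And>i. emeasure M (A i) \<noteq> \<infinity>" "incseq A" by blast
  from sigma_finite_measure.sigma_finite_incseq[OF assms(2)] obtain B :: "nat \<Rightarrow> _"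
    where B: "range B \<subseteq> sets N" "(\<Union>i. B i) = space N" "\<And>i. emeasure N (B i) \<noteq> \<infinity>" "incseq B" by blast
  have s: "A i \<in> sets M" "B i \<in> sets M" for i using A B by auto
  have fin: "emeasure M (A i \<inter> B i) \<noteq> \<infinity>" "emeasure N (A i \<inter> B i) \<noteq> \<infinity>" for i
    using neq_top_trans[OF _ emeasure_mono[of "A i \<inter> B i" "A i" M]]
      neq_top_trans[OF _ emeasure_mono[of "A i \<inter> B i" "B i" N]] A(3)[of i] B(3)[of i] s[of i] by auto
  have "space M \<subseteq> (\<Union>i. A i \<inter> B i)"
  proof
    fix x assume x: "x \<in> space M"
    then obtain i j where "x \<in> A i" "x \<in> B j" using A(2) B(2) sp by blast
    then have "x \<in> A (max i j) \<inter> B (max i j)"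
      using A(4) B(4) by (meson IntI incseqD max.cobounded1 max.cobounded2 subsetD)
    then show "x \<in> (\<Union>i. A i \<inter> B i)" by blast
  qed
  moreover have "(\<Union>i. A i \<inter> B i) \<subseteq> space M" using A(2) by blast
  ultimately have cov: "(\<Union>i. A i \<inter> B i) = space M" by (rule antisym[rotated])
  show ?thesis
  proof (rule sigma_finite_measure.intro, intro exI[of _ "range (\<lambda>i. A i \<inter> B i)"] conjI ballI)
    fix a assume "a \<in> range (\<lambda>i. A i \<inter> B i)"
    then show "emeasure (add_measure M N) a \<noteq> \<infinity>" using fin by (auto simp: emeasure_add_measure)
  qed (use s cov in auto)
qed

lemma emeasure_density_add:
  assumes [measurable]: "u \<in> borel_measurable M" "v \<in> borel_measurable M" "A \<in> sets M"
  shows "emeasure (density M u) A + emeasure (density M v) A = emeasure (density M (\<lambda>x. u x + v x)) A"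
  by (simp add: emeasure_density nn_integral_add[symmetric] distrib_right)

text \<open>With densities \<open>p\<close>, \<open>n\<close> with respect to \<open>P + N\<close>,
  the Jordan parts have densities \<open>(p - n)\<close> and \<open>(n - p)\<close> cut off at 0,
  and the common part \<open>\<rho>\<close> has density \<open>min p n\<close>. Keeping
  \<open>\<rho>\<close> expresses \<open>P\<close> and \<open>N\<close> by sums, so that energies of
  the difference can be computed by additivity. Sigma-finiteness serves twice: for the densities,
  and to show that the parts are Radon.\<close>

lemma radon_diff_decomposition:
  fixes P N :: "'a::t2_space measure"
  assumes P: "radon P" "sigma_finite_measure P" and N: "radon N" "sigma_finite_measure N"
  obtains \<alpha> \<beta> \<rho> where "radon \<alpha>" "radon \<beta>" "radon \<rho>" "signed_radon (\<alpha>, \<beta>)"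
    "radon_diff P N = (\<alpha>, \<beta>)" "P = add_measure \<alpha> \<rho>" "N = add_measure \<beta> \<rho>"
proof -
  note [simp] = radon_sets[OF P(1)] radon_sets[OF N(1)]
  define S where "S = add_measure P N"
  have setsS [simp, measurable_cong]: "sets S = sets borel" by (simp add: S_def)
  have spS [simp]: "space S = UNIV" using sets_eq_imp_space_eq[of S borel] by simp
  have emS: "emeasure S B = emeasure P B + emeasure N B" for B by (simp add: S_def emeasure_add_measure)
  interpret S: sigma_finite_measure S
    unfolding S_def by (rule sigma_finite_add_measure) (simp_all add: P N)
  have "absolutely_continuous S P" "absolutely_continuous S N"
    by (auto simp: absolutely_continuous_def null_sets_def emS)
  then obtain p n where pn [measurable]: "p \<in> borel_measurable S" "n \<in> borel_measurable S"
    and p: "density S p = P" and n: "density S n = N"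
    using S.Radon_Nikodym[of P] S.Radon_Nikodym[of N] by auto
  \<comment> \<open>Where \<open>p x = n x = \<infinity>\<close>, subtraction in
    \<open>ennreal\<close> would give \<open>\<infinity>\<close>; the guard makes the density 0
    there.\<close>
  define \<alpha> where "\<alpha> = density S (\<lambda>x. if n x < p x then p x - n x else 0)"
  define \<beta> where "\<beta> = density S (\<lambda>x. if p x < n x then n x - p x else 0)"
  define \<rho> where "\<rho> = density S (\<lambda>x. min (p x) (n x))"
  have sets3 [simp]: "sets \<alpha> = sets borel" "sets \<beta> = sets borel" "sets \<rho> = sets borel"
    by (simp_all add: \<alpha>_def \<beta>_def \<rho>_def)
  have d: "a - b + b = (a::ennreal)" if "b < a" for a b
    using that by (simp add: diff_add_cancel_ennreal)
  have eP: "emeasure \<alpha> B + emeasure \<rho> B = emeasure P B" if B: "B \<in> sets borel" for B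
  proof -
    have "(\<lambda>x. (if n x < p x then p x - n x else 0) + min (p x) (n x)) = p"
      by (auto simp: fun_eq_iff min_def d)
    then show ?thesis unfolding \<alpha>_def \<rho>_def using B by (simp add: emeasure_density_add p)
  qed
  have eN: "emeasure \<beta> B + emeasure \<rho> B = emeasure N B" if B: "B \<in> sets borel" for B
  proof -
    have "(\<lambda>x. (if p x < n x then n x - p x else 0) + min (p x) (n x)) = n"
      by (auto simp: fun_eq_iff min_def d)
    then show ?thesis unfolding \<beta>_def \<rho>_def using B by (simp add: emeasure_density_add n)
  qed
  have le_radon: "radon \<tau>"
    if M: "radon M" "sigma_finite_measure M" and \<tau>: "sets \<tau> = sets borel"
      "\<And>B. B \<in> sets borel \<Longrightarrow> emeasure \<tau> B \<le> emeasure M B" for \<tau> M :: "'a measure"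
  proof -
    from sigma_finite_measure.sigma_finite_incseq[OF M(2)] obtain A :: "nat \<Rightarrow> _"
      where A: "range A \<subseteq> sets M" "(\<Union>i. A i) = space M" "\<And>i. emeasure M (A i) \<noteq> \<infinity>" "incseq A" by blast
    show ?thesis
      by (rule radon_le[OF M(1) \<tau>, of A])
         (use A radon_sets[OF M(1)] radon_space[OF M(1)] in \<open>auto simp: less_top\<close>)
  qed
  have leP: "emeasure \<alpha> B \<le> emeasure P B" "emeasure \<rho> B \<le> emeasure P B" "emeasure \<beta> B \<le> emeasure N B"
    if "B \<in> sets borel" for B
    unfolding eP[OF that, symmetric] eN[OF that, symmetric] by simp_all
  have r: "radon \<alpha>" "radon \<beta>" "radon \<rho>"
    using le_radon[OF P, of \<alpha>] le_radon[OF P, of \<rho>] le_radon[OF N, of \<beta>] leP by simp_all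
  have sr: "signed_radon (\<alpha>, \<beta>)"
    unfolding signed_radon_def fst_conv snd_conv
  proof (intro conjI r allI impI)
    fix \<tau> :: "'a measure" assume \<tau>: "radon \<tau>" "measure_le \<tau> \<alpha>" "measure_le \<tau> \<beta>"
    have [simp]: "sets \<tau> = sets borel" by (rule radon_sets[OF \<tau>(1)])
    \<comment> \<open>\<open>\<beta>\<close> vanishes on \<open>Y\<close> and
      \<open>\<alpha>\<close> off \<open>Y\<close>, so a measure below both is null on either
      part.\<close>
    define Y where "Y = {x \<in> space S. n x < p x}"
    have "Y \<in> sets S" unfolding Y_def by measurable
    then have Y: "Y \<in> sets borel" by simp
    have "emeasure \<beta> (Y) = 0"
    proof -
      have "(\<lambda>x. (if p x < n x then n x - p x else 0) * indicator (Y) x) = (\<lambda>_. 0)"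
        by (auto simp: fun_eq_iff Y_def indicator_def)
      then show ?thesis unfolding \<beta>_def using Y by (subst emeasure_density) simp_all
    qed
    moreover have "emeasure \<alpha> (- Y) = 0"
    proof -
      have "(\<lambda>x. (if n x < p x then p x - n x else 0) * indicator (- Y) x) = (\<lambda>_. 0)"
        by (auto simp: fun_eq_iff Y_def indicator_def)
      then show ?thesis unfolding \<alpha>_def using Y by (subst emeasure_density) simp_all
    qed
    moreover have "emeasure \<tau> Y \<le> emeasure \<beta> Y" "emeasure \<tau> (- Y) \<le> emeasure \<alpha> (- Y)"
      using \<tau>(2,3) Y by (auto simp: measure_le_def)
    ultimately have "emeasure \<tau> Y + emeasure \<tau> (- Y) \<le> 0" by simp
    moreover have "emeasure \<tau> UNIV = emeasure \<tau> Y + emeasure \<tau> (- Y)"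
      using Y by (subst plus_emeasure) auto
    ultimately show "emeasure \<tau> UNIV = 0" by simp
  qed
  have "radon_diff P N = (\<alpha>, \<beta>)"
    by (rule radon_diff_eqI[OF P(1) N(1) sr]) (simp add: eP[symmetric] eN[symmetric] ac_simps)
  moreover have "P = add_measure \<alpha> \<rho>" "N = add_measure \<beta> \<rho>"
    by (auto intro!: measure_eqI simp: emeasure_add_measure eP eN)
  ultimately show ?thesis using that r sr by blast
qed

section \<open>Energies\<close>

text \<open>Finite negative parts rule out \<open>\<infinity> - \<infinity>\<close>, so the
  difference may be regrouped even when positive parts are infinite.\<close>

lemma ereal_integral_add_measure:
  assumes s: "sets N = sets M" and f: "f \<in> borel_measurable M"
    and fin: "(\<integral>\<^sup>+x. e2ennreal (- f x) \<partial>M) < \<infinity>" "(\<integral>\<^sup>+x. e2ennreal (- f x) \<partial>N) < \<infinity>"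
  shows "ereal_integral (add_measure M N) f = ereal_integral M f + ereal_integral N f"
proof -
  have m: "(\<lambda>x. e2ennreal (f x)) \<in> borel_measurable M" "(\<lambda>x. e2ennreal (- f x)) \<in> borel_measurable M"
    using f by simp_all
  obtain n n' where n: "(\<integral>\<^sup>+x. e2ennreal (- f x) \<partial>M) = ennreal n" "0 \<le> n"
      "(\<integral>\<^sup>+x. e2ennreal (- f x) \<partial>N) = ennreal n'" "0 \<le> n'"
    using fin by (metis ennreal_cases infinity_ennreal_def less_irrefl)
  have alg: "(p + p') - (ereal n + ereal n') = (p - ereal n) + (p' - ereal n')" if "0 \<le> p" "0 \<le> p'" for p p'
    using that by (cases p; cases p') auto
  show ?thesis
    unfolding ereal_integral_def nn_integral_add_measure[OF s m(1)] nn_integral_add_measure[OF s m(2)]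
    unfolding n(1,3) plus_ennreal.rep_eq enn2ereal_ennreal[OF n(2)] enn2ereal_ennreal[OF n(4)]
    by (rule alg) simp_all
qed

lemma ereal_integral_neq_minus_infinity:
  assumes "(\<integral>\<^sup>+x. e2ennreal (- f x) \<partial>M) < \<infinity>"
  shows "ereal_integral M f \<noteq> - \<infinity>"
proof -
  obtain n where n: "(\<integral>\<^sup>+x. e2ennreal (- f x) \<partial>M) = ennreal n" "0 \<le> n"
    using assms by (metis ennreal_cases infinity_ennreal_def less_irrefl)
  have "0 \<le> enn2ereal (\<integral>\<^sup>+x. e2ennreal (f x) \<partial>M)" by simp
  then show ?thesis unfolding ereal_integral_def n(1) using n(2)
    by (cases "enn2ereal (\<integral>\<^sup>+x. e2ennreal (f x) \<partial>M)") (auto simp: enn2ereal_ennreal)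
qed

lemma kernel_borel_measurable:
  "symmetric_lsc_kernel \<kappa> \<Longrightarrow> \<kappa> \<in> borel_measurable borel"
  by (intro borel_measurableI_greater) (auto simp: symmetric_lsc_kernel_def lower_semicontinuous_def)

text \<open>For compact \<open>X\<close> the open sets where the kernel exceeds \<open>-n\<close>
  cover \<open>X \<times> X\<close>, and finitely many suffice. The alternative in the conclusion is
  recorded because a constant \<open>c\<close> is integrable only if it is 0 or the total mass is
  finite.\<close>

lemma lsc_kernel_bounded_below:
  fixes \<kappa> :: "'a::topological_space \<times> 'a \<Rightarrow> ereal"
  assumes k: "symmetric_lsc_kernel \<kappa>"
  obtains c :: real where "\<And>z. - ereal c \<le> \<kappa> z" "compact (UNIV :: 'a set) \<or> c = 0" "0 \<le> c"
proof (cases "compact (UNIV :: 'a set)")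
  case True
  then have cp: "compact (UNIV \<times> UNIV :: ('a \<times> 'a) set)" by (intro compact_Times)
  have cov: "(UNIV \<times> UNIV :: ('a \<times> 'a) set) \<subseteq> (\<Union>n\<in>(UNIV :: nat set). {z. - ereal (real n) < \<kappa> z})"
  proof
    fix z
    have "\<kappa> z \<noteq> - \<infinity>" using k by (cases z) (simp add: symmetric_lsc_kernel_def)
    then obtain r where r: "ereal r < \<kappa> z" using ereal_dense2[of "-\<infinity>" "\<kappa> z"] by auto
    obtain n :: nat where "- r \<le> real n" using real_arch_simple by blast
    then have "- ereal (real n) \<le> ereal r" by simp
    with r have "- ereal (real n) < \<kappa> z" by (rule le_less_trans[rotated])
    then show "z \<in> (\<Union>n. {z. - ereal (real n) < \<kappa> z})" by blast
  qed
  have op: "open {z. - ereal (real n) < \<kappa> z}" for n :: nat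
    using k unfolding symmetric_lsc_kernel_def lower_semicontinuous_def by blast
  obtain F where F: "finite (F :: nat set)"
      "(UNIV \<times> UNIV :: ('a \<times> 'a) set) \<subseteq> (\<Union>n\<in>F. {z. - ereal (real n) < \<kappa> z})"
    by (rule compactE_image[OF cp op cov])
  show ?thesis
  \<comment> \<open>Any upper bound of the finite set \<open>F\<close> serves; the sum is one
    because its terms are nonnegative.\<close>
  proof (rule that[of "real (\<Sum>n\<in>F. n)"])
    fix z :: "'a \<times> 'a"
    have "z \<in> UNIV \<times> UNIV" by simp
    then obtain n where n: "n \<in> F" "- ereal (real n) < \<kappa> z" using F(2) by blast
    have "n \<le> (\<Sum>n\<in>F. n)" using n(1) F(1) by (intro member_le_sum) auto
    then have "- ereal (real (\<Sum>n\<in>F. n)) \<le> - ereal (real n)" by (simp del: of_nat_sum)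
    with n(2) show "- ereal (real (\<Sum>n\<in>F. n)) \<le> \<kappa> z" by (meson le_less_trans less_imp_le)
  qed (use True in \<open>auto intro: sum_nonneg\<close>)
next
  case False
  with k show ?thesis by (intro that[of 0]) (auto simp: symmetric_lsc_kernel_def zero_ereal_def[symmetric])
qed

text \<open>The class in which differences can be decomposed; it is closed under addition and
  contains all components of admissible vectors.\<close>

definition sigma_radon :: "'a::topological_space measure \<Rightarrow> bool" where
  "sigma_radon \<mu> \<longleftrightarrow> radon \<mu> \<and> sigma_finite_measure \<mu>"

lemma sigma_radon_add_measure:
  fixes \<mu> \<nu> :: "'a::t2_space measure"
  shows "sigma_radon \<mu> \<Longrightarrow> sigma_radon \<nu> \<Longrightarrow> sigma_radon (add_measure \<mu> \<nu>)"
  by (simp add: sigma_radon_def radon_add_measure sigma_finite_add_measure radon_sets)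

locale energy_kernel =
  fixes \<kappa> :: "'a::t2_space \<times> 'a \<Rightarrow> ereal"
  assumes lc: "locally_compact_space (euclidean :: 'a topology)"
    and kernel: "symmetric_lsc_kernel \<kappa>" and pd: "positive_definite \<kappa>"
begin

abbreviation E :: "'a measure \<Rightarrow> 'a measure \<Rightarrow> ereal" where "E \<equiv> mutual_energy \<kappa>"

definition e :: "'a measure \<Rightarrow> 'a measure \<Rightarrow> real" where "e \<mu> \<nu> = real_of_ereal (E \<mu> \<nu>)"

definition fin :: "'a measure \<Rightarrow> 'a measure \<Rightarrow> bool" where "fin \<mu> \<nu> \<longleftrightarrow> \<bar>E \<mu> \<nu>\<bar> \<noteq> \<infinity>"

lemma fin_E: "fin \<mu> \<nu> \<Longrightarrow> E \<mu> \<nu> = ereal (e \<mu> \<nu>)"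
  by (auto simp: fin_def e_def ereal_real)

text \<open>The negative part is at most the constant \<open>c\<close>. Either \<open>c = 0\<close>,
  or \<open>X \<times> X\<close> is compact and the product measure has finite mass.\<close>

lemma negative_part_finite:
  assumes "radon \<mu>" "radon \<nu>"
  shows "(\<integral>\<^sup>+z. e2ennreal (- \<kappa> z) \<partial>radon_prod \<mu> \<nu>) < \<infinity>"
proof -
  let ?M = "radon_prod \<mu> \<nu>"
  have r: "radon ?M" by (rule radon_radon_prod[OF lc lc assms])
  from lsc_kernel_bounded_below[OF kernel] obtain c
    where c: "\<And>z. - ereal c \<le> \<kappa> z" "compact (UNIV :: 'a set) \<or> c = 0" "0 \<le> c" by blast
  have "(\<integral>\<^sup>+z. e2ennreal (- \<kappa> z) \<partial>?M) \<le> (\<integral>\<^sup>+z. ennreal c \<partial>?M)"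
  proof (rule nn_integral_mono)
    fix z
    have "- \<kappa> z \<le> ereal c" using c(1)[of z] by (simp add: ereal_uminus_le_reorder)
    then have "e2ennreal (- \<kappa> z) \<le> e2ennreal (ereal c)" by (rule e2ennreal_mono)
    then show "e2ennreal (- \<kappa> z) \<le> ennreal c" by (simp add: ennreal.abs_eq e2ennreal_def ennreal_def)
  qed
  also have "\<dots> = ennreal c * emeasure ?M UNIV" by (simp add: radon_space[OF r])
  also have "\<dots> < \<infinity>"
  proof (cases "c = 0")
    case False
    then have "compact (UNIV \<times> UNIV :: ('a \<times> 'a) set)" using c(2) by (intro compact_Times) auto
    then show ?thesis using radon_compact_finite[OF r, of UNIV] by (simp add: ennreal_mult_less_top)
  qed simp
  finally show ?thesis .
qed

lemma E_neq_minus_infinity: "radon \<mu> \<Longrightarrow> radon \<nu> \<Longrightarrow> E \<mu> \<nu> \<noteq> - \<infinity>"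
  unfolding mutual_energy_def by (intro ereal_integral_neq_minus_infinity negative_part_finite)

lemma E_nonneg:
  assumes "\<not> compact (UNIV :: 'a set)"
  shows "0 \<le> E \<mu> \<nu>"
proof -
  have "0 \<le> \<kappa> z" for z using kernel assms by (cases z) (simp add: symmetric_lsc_kernel_def)
  then have "e2ennreal (- \<kappa> z) = 0" for z by (intro e2ennreal_neg) simp
  then show ?thesis by (simp add: mutual_energy_def ereal_integral_def zero_ennreal.rep_eq)
qed

lemma E_add_left:
  assumes "radon \<mu>" "radon \<mu>'" "radon \<nu>"
  shows "E (add_measure \<mu> \<mu>') \<nu> = E \<mu> \<nu> + E \<mu>' \<nu>"
proof -
  have s: "sets (radon_prod \<mu> \<nu>) = sets borel" "sets (radon_prod \<mu>' \<nu>) = sets borel"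
    using radon_sets[OF radon_radon_prod[OF lc lc]] assms by blast+
  then have "\<kappa> \<in> borel_measurable (radon_prod \<mu> \<nu>)"
    using kernel_borel_measurable[OF kernel] measurable_cong_sets[OF s(1) refl] by blast
  with s assms show ?thesis
    unfolding mutual_energy_def radon_prod_add_left[OF lc lc assms]
    by (intro ereal_integral_add_measure negative_part_finite) simp_all
qed

lemma E_add_right:
  assumes "radon \<mu>" "radon \<nu>" "radon \<nu>'"
  shows "E \<mu> (add_measure \<nu> \<nu>') = E \<mu> \<nu> + E \<mu> \<nu>'"
proof -
  have s: "sets (radon_prod \<mu> \<nu>) = sets borel" "sets (radon_prod \<mu> \<nu>') = sets borel"
    using radon_sets[OF radon_radon_prod[OF lc lc]] assms by blast+
  then have "\<kappa> \<in> borel_measurable (radon_prod \<mu> \<nu>)"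
    using kernel_borel_measurable[OF kernel] measurable_cong_sets[OF s(1) refl] by blast
  with s assms show ?thesis
    unfolding mutual_energy_def radon_prod_add_right[OF lc lc assms]
    by (intro ereal_integral_add_measure negative_part_finite) simp_all
qed

text \<open>Neither summand is \<open>- \<infinity>\<close>, so an infinite one cannot be
  compensated. In this way the finiteness assumed for \<open>P\<close> and \<open>N\<close> is
  inherited by their Jordan and common parts.\<close>

lemma fin_add_left:
  assumes "radon \<mu>" "radon \<mu>'" "radon \<nu>"
  shows "fin (add_measure \<mu> \<mu>') \<nu> \<longleftrightarrow> fin \<mu> \<nu> \<and> fin \<mu>' \<nu>"
  using E_neq_minus_infinity[of \<mu> \<nu>] E_neq_minus_infinity[of \<mu>' \<nu>] assms
  by (cases "E \<mu> \<nu>"; cases "E \<mu>' \<nu>") (simp_all add: fin_def E_add_left)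

lemma fin_add_right:
  assumes "radon \<mu>" "radon \<nu>" "radon \<nu>'"
  shows "fin \<mu> (add_measure \<nu> \<nu>') \<longleftrightarrow> fin \<mu> \<nu> \<and> fin \<mu> \<nu>'"
  using E_neq_minus_infinity[of \<mu> \<nu>] E_neq_minus_infinity[of \<mu> \<nu>'] assms
  by (cases "E \<mu> \<nu>"; cases "E \<mu> \<nu>'") (simp_all add: fin_def E_add_right)

lemma e_add_left:
  assumes "radon \<mu>" "radon \<mu>'" "radon \<nu>" "fin \<mu> \<nu>" "fin \<mu>' \<nu>"
  shows "e (add_measure \<mu> \<mu>') \<nu> = e \<mu> \<nu> + e \<mu>' \<nu>"
  using assms by (simp add: e_def[of "add_measure \<mu> \<mu>'"] E_add_left fin_E)

lemma e_add_right:
  assumes "radon \<mu>" "radon \<nu>" "radon \<nu>'" "fin \<mu> \<nu>" "fin \<mu> \<nu>'"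
  shows "e \<mu> (add_measure \<nu> \<nu>') = e \<mu> \<nu> + e \<mu> \<nu>'"
  using assms by (simp add: e_def[of _ "add_measure \<nu> \<nu>'"] E_add_right fin_E)

text \<open>After \<open>P = a + r\<close>, \<open>N = b + r\<close> and the same for
  \<open>P'\<close>, \<open>N'\<close> are expanded, every term containing \<open>r\<close> or
  \<open>r'\<close> cancels.\<close>

lemma signed_mutual_energy_radon_diff:
  assumes s: "sigma_radon P" "sigma_radon N" "sigma_radon P'" "sigma_radon N'"
    and f: "fin P P'" "fin P N'" "fin N P'" "fin N N'"
  shows "signed_mutual_energy \<kappa> (radon_diff P N) (radon_diff P' N') = ereal (e P P' + e N N' - e P N' - e N P')"
proof -
  obtain a b r where d: "radon a" "radon b" "radon r" "radon_diff P N = (a, b)"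
      "P = add_measure a r" "N = add_measure b r"
    using radon_diff_decomposition[of P N] s unfolding sigma_radon_def by metis
  obtain a' b' r' where d': "radon a'" "radon b'" "radon r'" "radon_diff P' N' = (a', b')"
      "P' = add_measure a' r'" "N' = add_measure b' r'"
    using radon_diff_decomposition[of P' N'] s unfolding sigma_radon_def by metis
  have f': "fin x y" if "x \<in> {a, b, r}" "y \<in> {a', b', r'}" for x y
    using f that d(1-3) d'(1-3) unfolding d(5,6) d'(5,6)
    by (auto simp: fin_add_left fin_add_right radon_add_measure)
  show ?thesis
    unfolding d(4) d'(4) signed_mutual_energy_def fst_conv snd_conv unfolding d(5,6) d'(5,6)
    using d(1-3) d'(1-3) f'
    by (simp add: fin_E e_add_left e_add_right fin_add_right radon_add_measure)
qed

text \<open>Finite mutual energy is a conclusion, not a hypothesis: the Jordan parts have finite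
  energies as summands of \<open>P\<close> and \<open>N\<close>, so positive definiteness applies to
  their difference and controls the mixed terms.\<close>

lemma cross_energy:
  assumes s: "sigma_radon P" "sigma_radon N" and f: "fin P P" "fin N N"
  shows "fin P N" "e P N + e N P \<le> e P P + e N N"
proof -
  obtain a b r where d: "radon a" "radon b" "radon r" "signed_radon (a, b)"
      "P = add_measure a r" "N = add_measure b r"
    using radon_diff_decomposition[of P N] s unfolding sigma_radon_def by metis
  have f': "fin a a" "fin a r" "fin r a" "fin r r" "fin b b" "fin b r" "fin r b"
    using f d(1-3) unfolding d(5,6) by (auto simp: fin_add_left fin_add_right radon_add_measure)
  have "energy_defined \<kappa> (a, b)"
    using f' by (simp add: energy_defined_def fin_E)
  then have "0 \<le> signed_mutual_energy \<kappa> (a, b) (a, b)"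
    using pd d(4) unfolding positive_definite_def by blast
  then have nn: "0 \<le> ereal (e a a + e b b) - (E a b + E b a)"
    using f' by (simp add: signed_mutual_energy_def fin_E)
  \<comment> \<open>An infinite mixed energy can only be \<open>\<infinity>\<close>, and would make
    the nonnegative value in \<open>nn\<close> equal to \<open>- \<infinity>\<close>.\<close>
  with E_neq_minus_infinity[OF d(1,2)] E_neq_minus_infinity[OF d(2,1)]
  have f2: "fin a b" "fin b a"
    by (cases "E a b"; cases "E b a"; simp add: fin_def)+
  with f' d(1-3) show "fin P N"
    unfolding d(5,6) by (simp add: fin_add_left fin_add_right radon_add_measure)
  have "0 \<le> e a a + e b b - e a b - e b a" using nn f2 by (simp add: fin_E)
  then show "e P N + e N P \<le> e P P + e N N"
    unfolding d(5,6) using d(1-3) f' f2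
    by (simp add: e_add_left e_add_right fin_add_right radon_add_measure)
qed

text \<open>The sum enters only through its mutual energies, so these alone are recorded.
  Nonemptiness of \<open>F\<close> spares the zero measure as a base case.\<close>

lemma finite_sum_measure:
  assumes "finite F" "F \<noteq> {}" "\<And>i. i \<in> F \<Longrightarrow> sigma_radon (\<mu> i)"
  shows "\<exists>P. sigma_radon P \<and> (\<forall>\<nu>. radon \<nu> \<longrightarrow> E P \<nu> = (\<Sum>i\<in>F. E (\<mu> i) \<nu>) \<and> E \<nu> P = (\<Sum>i\<in>F. E \<nu> (\<mu> i)))"
  using assms
proof (induction rule: finite_ne_induct)
  case (singleton i)
  then show ?case by (intro exI[of _ "\<mu> i"]) auto
next
  case (insert i F)
  then obtain P where P: "sigma_radon P"
      "\<And>\<nu>. radon \<nu> \<Longrightarrow> E P \<nu> = (\<Sum>i\<in>F. E (\<mu> i) \<nu>) \<and> E \<nu> P = (\<Sum>i\<in>F. E \<nu> (\<mu> i))"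
    by auto
  have i: "sigma_radon (\<mu> i)" using insert by simp
  have r: "radon P" "radon (\<mu> i)" using P(1) i by (auto simp: sigma_radon_def)
  show ?case
    using insert(1,3) P r sigma_radon_add_measure[OF i P(1)]
    by (intro exI[of _ "add_measure (\<mu> i) P"]) (auto simp: E_add_left E_add_right)
qed

text \<open>This is \<open>cross_energy\<close> for \<open>P\<close>, the sum of all
  \<open>x i\<close>, and \<open>N\<close>, the sum of all \<open>y i\<close>, with the energies
  expanded into double sums.\<close>

lemma double_sum_cross_energy:
  assumes F: "finite F" and x: "\<And>i. i \<in> F \<Longrightarrow> sigma_radon (x i)" and y: "\<And>i. i \<in> F \<Longrightarrow> sigma_radon (y i)"
    and fx: "\<And>i j. i \<in> F \<Longrightarrow> j \<in> F \<Longrightarrow> fin (x i) (x j)" and fy: "\<And>i j. i \<in> F \<Longrightarrow> j \<in> F \<Longrightarrow> fin (y i) (y j)"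
  shows "(\<Sum>i\<in>F. \<Sum>j\<in>F. e (x i) (y j)) + (\<Sum>i\<in>F. \<Sum>j\<in>F. e (y i) (x j))
      \<le> (\<Sum>i\<in>F. \<Sum>j\<in>F. e (x i) (x j)) + (\<Sum>i\<in>F. \<Sum>j\<in>F. e (y i) (y j))"
proof (cases "F = {}")
  case False
  obtain P where P: "sigma_radon P" "\<And>\<nu>. radon \<nu> \<Longrightarrow> E P \<nu> = (\<Sum>i\<in>F. E (x i) \<nu>)"
      "\<And>\<nu>. radon \<nu> \<Longrightarrow> E \<nu> P = (\<Sum>i\<in>F. E \<nu> (x i))"
    using finite_sum_measure[of F x] F False x by blast
  obtain N where N: "sigma_radon N" "\<And>\<nu>. radon \<nu> \<Longrightarrow> E N \<nu> = (\<Sum>i\<in>F. E (y i) \<nu>)"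
      "\<And>\<nu>. radon \<nu> \<Longrightarrow> E \<nu> N = (\<Sum>i\<in>F. E \<nu> (y i))"
    using finite_sum_measure[of F y] F False y by blast
  have r: "radon P" "radon N" "\<And>i. i \<in> F \<Longrightarrow> radon (x i)" "\<And>i. i \<in> F \<Longrightarrow> radon (y i)"
    using P(1) N(1) x y by (auto simp: sigma_radon_def)
  have xy: "fin (x i) (y j)" "fin (y i) (x j)" if "i \<in> F" "j \<in> F" for i j
    using cross_energy(1)[OF x y fx fy] cross_energy(1)[OF y x fy fx] that by blast+
  have PP: "E P P = ereal (\<Sum>i\<in>F. \<Sum>j\<in>F. e (x i) (x j))"
    using r fx by (simp add: P(2) P(3)[OF r(3)] fin_E)
  have NN: "E N N = ereal (\<Sum>i\<in>F. \<Sum>j\<in>F. e (y i) (y j))"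
    using r fy by (simp add: N(2) N(3)[OF r(4)] fin_E)
  have PN: "E P N = ereal (\<Sum>i\<in>F. \<Sum>j\<in>F. e (x i) (y j))"
    using r xy by (simp add: P(2) N(3)[OF r(3)] fin_E)
  have NP: "E N P = ereal (\<Sum>i\<in>F. \<Sum>j\<in>F. e (y i) (x j))"
    using r xy by (simp add: N(2) P(3)[OF r(4)] fin_E)
  show ?thesis using cross_energy(2)[OF P(1) N(1)] by (simp add: fin_def e_def PP NN PN NP)
qed simp

end

section \<open>Pairings and midpoints\<close>

text \<open>Completion does not change the nonnegative integrals, and
  \<open>\<infinity> - \<infinity> = \<infinity>\<close> in \<open>ereal\<close>; a finite pairing
  thus has two finite parts.\<close>

lemma pairing_finiteE:
  assumes "\<bar>pairing f \<mu>\<bar> \<noteq> \<infinity>"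
  obtains p n where "0 \<le> p" "0 \<le> n" "(\<integral>\<^sup>+x. e2ennreal (f x) \<partial>\<mu>) = ennreal p"
    "(\<integral>\<^sup>+x. e2ennreal (- f x) \<partial>\<mu>) = ennreal n" "pairing f \<mu> = ereal (p - n)"
proof -
  have eq: "pairing f \<mu> = enn2ereal (\<integral>\<^sup>+x. e2ennreal (f x) \<partial>\<mu>) - enn2ereal (\<integral>\<^sup>+x. e2ennreal (- f x) \<partial>\<mu>)"
    by (simp add: pairing_def ereal_integral_def nn_integral_completion)
  show ?thesis
    using assms that unfolding eq
    by (cases "\<integral>\<^sup>+x. e2ennreal (f x) \<partial>\<mu>"; cases "\<integral>\<^sup>+x. e2ennreal (- f x) \<partial>\<mu>")
       (auto simp: enn2ereal_ennreal)
qed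

text \<open>The sets where \<open>g\<close> is at least \<open>1 / n\<close> exhaust the space
  because \<open>g > 0\<close>, and have finite measure by Markov's inequality.\<close>

lemma sigma_finite_measure_if_pairing_finite:
  fixes \<mu> :: "'a::topological_space measure"
  assumes s: "sets \<mu> = sets borel" and g: "g \<in> borel_measurable borel" "\<And>x. 0 < g x"
    and fin: "\<bar>pairing (\<lambda>x. ereal (g x)) \<mu>\<bar> \<noteq> \<infinity>"
  shows "sigma_finite_measure \<mu>"
proof -
  have sp: "space \<mu> = UNIV" using sets_eq_imp_space_eq[OF s] by simp
  have gm [measurable]: "g \<in> borel_measurable \<mu>" using g(1) measurable_cong_sets[OF s refl] by blast
  obtain p where p: "(\<integral>\<^sup>+x. e2ennreal (ereal (g x)) \<partial>\<mu>) = ennreal p"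
    using pairing_finiteE[OF fin] by metis
  have e: "e2ennreal (ereal (g x)) = ennreal (g x)" for x
    by (simp add: e2ennreal_ereal)
  define A where "A n = {x \<in> space \<mu>. 1 \<le> ennreal (real n) * ennreal (g x)}" for n :: nat
  have "emeasure \<mu> (A n) \<le> ennreal (real n) * (\<integral>\<^sup>+x. ennreal (g x) * indicator (space \<mu>) x \<partial>\<mu>)" for n
    unfolding A_def by (rule nn_integral_Markov_inequality) measurable
  also have "(\<integral>\<^sup>+x. ennreal (g x) * indicator (space \<mu>) x \<partial>\<mu>) = ennreal p"
    using p by (simp add: sp e)
  finally have "emeasure \<mu> (A n) \<le> ennreal (real n) * ennreal p" for n .
  moreover have "ennreal (real n) * ennreal p < \<infinity>" for n by (simp add: ennreal_mult_less_top)
  ultimately have finA: "emeasure \<mu> (A n) \<noteq> \<infinity>" for n by (metis leD)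
  have "x \<in> (\<Union>n. A n)" for x
  proof -
    obtain n :: nat where n: "1 / g x \<le> real n" using real_arch_simple by blast
    then have "1 \<le> real n * g x" using g(2)[of x] by (simp add: field_simps)
    then have "ennreal 1 \<le> ennreal (real n * g x)" by (rule ennreal_leI)
    then have "x \<in> A n" using g(2)[of x] by (simp add: A_def sp ennreal_mult less_imp_le)
    then show ?thesis by blast
  qed
  then have cov: "(\<Union>n. A n) = space \<mu>" using sp by blast
  have "A n \<in> sets \<mu>" for n unfolding A_def by measurable
  then show ?thesis
    using finA cov by (intro sigma_finite_measure.intro exI[of _ "range A"]) auto
qed

text \<open>If \<open>S \<subseteq> E\<close> with remainder inside the \<open>M\<close>-null set
  \<open>T'\<close>, and \<open>U \<subseteq> E\<close> with remainder inside the
  \<open>N\<close>-null set \<open>V'\<close>, then \<open>S \<union> U\<close> misses only a part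
  of \<open>T' \<inter> V'\<close>, which is null for both measures.\<close>

lemma sets_completion_if_both:
  assumes s: "sets N = sets M" "sets Q = sets M"
    and null: "null_sets M \<inter> null_sets N \<subseteq> null_sets Q"
    and E: "E \<in> sets (completion M)" "E \<in> sets (completion N)"
  shows "E \<in> sets (completion Q)"
proof -
  obtain S T T' where 1: "E = S \<union> T" "T \<subseteq> T'" "T' \<in> null_sets M" "S \<in> sets M"
    using sets_completionE[OF E(1)] .
  obtain U V V' where 2: "E = U \<union> V" "V \<subseteq> V'" "V' \<in> null_sets N" "U \<in> sets N"
    using sets_completionE[OF E(2)] .
  show ?thesis
  proof (rule sets_completionI)
    show "E = (S \<union> U) \<union> (E - (S \<union> U))" using 1(1) 2(1) by blast
    show "E - (S \<union> U) \<subseteq> T' \<inter> V'" using 1(1,2) 2(1,2) by blast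
    have "T' \<in> sets N" "V' \<in> sets M" using 1(3) 2(3) s by auto
    then have "T' \<inter> V' \<in> null_sets M" "T' \<inter> V' \<in> null_sets N"
      using 1(3) 2(3) by (auto intro: null_set_Int1 null_set_Int2)
    then show "T' \<inter> V' \<in> null_sets Q" using null by blast
    show "S \<union> U \<in> sets Q" using 1(4) 2(4) s by auto
  qed
qed

lemma measurable_completion_if_both:
  assumes s: "sets N = sets M" "sets Q = sets M"
    and null: "null_sets M \<inter> null_sets N \<subseteq> null_sets Q"
    and f: "f \<in> borel_measurable (completion M)" "f \<in> borel_measurable (completion N)"
  shows "f \<in> borel_measurable (completion Q)"
proof -
  have sp: "space N = space M" "space Q = space M" using s by (auto dest: sets_eq_imp_space_eq)
  show ?thesis
  proof (rule measurableI)
    fix B :: "'b set" assume B: "B \<in> sets borel"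
    have "f -` B \<inter> space M \<in> sets (completion M)" "f -` B \<inter> space M \<in> sets (completion N)"
      using measurable_sets[OF f(1) B] measurable_sets[OF f(2) B] sp by auto
    from sets_completion_if_both[OF s null this]
    show "f -` B \<inter> space (completion Q) \<in> sets (completion Q)" using sp by simp
  qed simp
qed

definition mid_measure :: "'a measure \<Rightarrow> 'a measure \<Rightarrow> 'a measure" where
  "mid_measure \<mu> \<nu> = scale_measure (ennreal (1/2)) (add_measure \<mu> \<nu>)"

lemma sets_mid_measure [simp]: "sets (mid_measure \<mu> \<nu>) = sets \<mu>"
  by (simp add: mid_measure_def)

lemma emeasure_mid_measure:
  "sets \<nu> = sets \<mu> \<Longrightarrow> emeasure (mid_measure \<mu> \<nu>) B = ennreal (1/2) * (emeasure \<mu> B + emeasure \<nu> B)"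
  by (simp add: mid_measure_def emeasure_add_measure del: ennreal_half)

lemma ennreal_half_plus_half: "ennreal (1/2) * x + ennreal (1/2) * x = x"
proof -
  have "ennreal (1/2) + ennreal (1/2) = 1" by (subst ennreal_plus[symmetric]) simp_all
  then show ?thesis by (metis distrib_right mult_1)
qed

text \<open>Through this identity the energies of midpoints follow from additivity alone, without a
  separate homogeneity law for the product measure.\<close>

lemma add_measure_mid_measure:
  assumes "sets \<nu> = sets \<mu>"
  shows "add_measure (mid_measure \<mu> \<nu>) (mid_measure \<mu> \<nu>) = add_measure \<mu> \<nu>"
  using assms
  by (intro measure_eqI) (simp_all add: emeasure_add_measure emeasure_mid_measure ennreal_half_plus_half del: ennreal_half)

lemma radon_mid_measure:
  fixes \<mu> \<nu> :: "'a::t2_space measure"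
  shows "radon \<mu> \<Longrightarrow> radon \<nu> \<Longrightarrow> radon (mid_measure \<mu> \<nu>)"
  unfolding mid_measure_def by (intro radon_scale_measure radon_add_measure) (simp_all del: ennreal_half)

lemma null_sets_mid_measure:
  assumes "sets \<nu> = sets \<mu>"
  shows "null_sets (mid_measure \<mu> \<nu>) = null_sets \<mu> \<inter> null_sets \<nu>"
  using assms by (auto simp: null_sets_def emeasure_mid_measure)

text \<open>\<open>u\<close> is measurable only for completions. It is replaced by a function that
  is measurable before completion and equals \<open>u\<close> off a null set of the midpoint; such a
  set is null for \<open>\<mu>\<close> and for \<open>\<nu>\<close>.\<close>

lemma nn_integral_mid_measure:
  fixes u :: "'a \<Rightarrow> ennreal"
  assumes s: "sets \<nu> = sets \<mu>"
    and u: "u \<in> borel_measurable (completion \<mu>)" "u \<in> borel_measurable (completion \<nu>)"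
  shows "(\<integral>\<^sup>+x. u x \<partial>mid_measure \<mu> \<nu>) = ennreal (1/2) * ((\<integral>\<^sup>+x. u x \<partial>\<mu>) + (\<integral>\<^sup>+x. u x \<partial>\<nu>))"
proof -
  let ?m = "mid_measure \<mu> \<nu>"
  have sp: "space \<nu> = space \<mu>" "space ?m = space \<mu>" using s by (auto dest: sets_eq_imp_space_eq simp: sets_eq_imp_space_eq[OF sets_mid_measure])
  have "u \<in> borel_measurable (completion ?m)"
    using s by (intro measurable_completion_if_both[OF s _ _ u]) (simp_all add: null_sets_mid_measure)
  from completion_ex_borel_measurable[OF this] obtain v
    where v: "v \<in> borel_measurable ?m" and ae: "AE x in ?m. u x = v x" by blast
  obtain N where N: "{x \<in> space ?m. u x \<noteq> v x} \<subseteq> N" "emeasure ?m N = 0" "N \<in> sets ?m"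
    using ae by (rule AE_E)
  then have "N \<in> null_sets ?m" by blast
  then have "N \<in> null_sets \<mu>" "N \<in> null_sets \<nu>" using null_sets_mid_measure[OF s] by auto
  then have ae': "AE x in \<mu>. u x = v x" "AE x in \<nu>. u x = v x"
    using N(1) sp by (auto intro!: AE_I'[of N])
  have vm: "v \<in> borel_measurable \<mu>" "v \<in> borel_measurable (add_measure \<mu> \<nu>)"
    using v measurable_cong_sets[OF sets_mid_measure refl] measurable_cong_sets[OF sets_add_measure refl] by blast+
  have "(\<integral>\<^sup>+x. u x \<partial>?m) = (\<integral>\<^sup>+x. v x \<partial>?m)" using ae by (rule nn_integral_cong_AE)
  also have "\<dots> = ennreal (1/2) * ((\<integral>\<^sup>+x. v x \<partial>\<mu>) + (\<integral>\<^sup>+x. v x \<partial>\<nu>))"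
    unfolding mid_measure_def nn_integral_scale_measure[OF vm(2)] nn_integral_add_measure[OF s vm(1)] ..
  also have "(\<integral>\<^sup>+x. v x \<partial>\<mu>) = (\<integral>\<^sup>+x. u x \<partial>\<mu>)" by (intro nn_integral_cong_AE) (use ae' in auto)
  also have "(\<integral>\<^sup>+x. v x \<partial>\<nu>) = (\<integral>\<^sup>+x. u x \<partial>\<nu>)" by (intro nn_integral_cong_AE) (use ae' in auto)
  finally show ?thesis .
qed

lemma
  assumes s: "sets \<nu> = sets \<mu>" and i: "radon_integrable \<mu> f" "radon_integrable \<nu> f"
  shows pairing_mid_measure: "pairing f (mid_measure \<mu> \<nu>) = ereal ((real_of_ereal (pairing f \<mu>) + real_of_ereal (pairing f \<nu>)) / 2)"
    and radon_integrable_mid_measure: "radon_integrable (mid_measure \<mu> \<nu>) f"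
proof -
  have m: "f \<in> borel_measurable (completion \<mu>)" "f \<in> borel_measurable (completion \<nu>)"
    and fin: "\<bar>pairing f \<mu>\<bar> \<noteq> \<infinity>" "\<bar>pairing f \<nu>\<bar> \<noteq> \<infinity>"
    using i by (auto simp: radon_integrable_def)
  obtain p n where pn: "0 \<le> p" "0 \<le> n" "(\<integral>\<^sup>+x. e2ennreal (f x) \<partial>\<mu>) = ennreal p"
      "(\<integral>\<^sup>+x. e2ennreal (- f x) \<partial>\<mu>) = ennreal n" "pairing f \<mu> = ereal (p - n)"
    using pairing_finiteE[OF fin(1)] .
  obtain p' n' where pn': "0 \<le> p'" "0 \<le> n'" "(\<integral>\<^sup>+x. e2ennreal (f x) \<partial>\<nu>) = ennreal p'"
      "(\<integral>\<^sup>+x. e2ennreal (- f x) \<partial>\<nu>) = ennreal n'" "pairing f \<nu> = ereal (p' - n')"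
    using pairing_finiteE[OF fin(2)] .
  have P: "(\<integral>\<^sup>+x. e2ennreal (f x) \<partial>mid_measure \<mu> \<nu>) = ennreal ((p + p') / 2)"
    using pn pn' m by (subst nn_integral_mid_measure[OF s]) (simp_all flip: ennreal_plus ennreal_mult' del: ennreal_half)
  have N: "(\<integral>\<^sup>+x. e2ennreal (- f x) \<partial>mid_measure \<mu> \<nu>) = ennreal ((n + n') / 2)"
    using pn pn' m by (subst nn_integral_mid_measure[OF s]) (simp_all flip: ennreal_plus ennreal_mult' del: ennreal_half)
  show eq: "pairing f (mid_measure \<mu> \<nu>) = ereal ((real_of_ereal (pairing f \<mu>) + real_of_ereal (pairing f \<nu>)) / 2)"
    using pn pn' unfolding pairing_def[of f "mid_measure \<mu> \<nu>"] ereal_integral_def nn_integral_completion P N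
    by (simp add: enn2ereal_ennreal field_simps)
  have "f \<in> borel_measurable (completion (mid_measure \<mu> \<nu>))"
    using s by (intro measurable_completion_if_both[OF s _ _ m]) (simp_all add: null_sets_mid_measure)
  then show "radon_integrable (mid_measure \<mu> \<nu>) f" by (simp add: radon_integrable_def eq)
qed

lemma Mplus_mid_measure:
  fixes \<mu> \<nu> :: "'a::t2_space measure"
  assumes A: "A \<in> sets borel" and m: "\<mu> \<in> Mplus A" "\<nu> \<in> Mplus A"
  shows "mid_measure \<mu> \<nu> \<in> Mplus A"
proof -
  have r: "radon \<mu>" "radon \<nu>" using m by (auto simp: Mplus_def)
  have s: "sets \<mu> = sets borel" "sets \<nu> = sets \<mu>" using r by (auto simp: radon_sets)
  have "- A \<inter> K \<in> null_sets (completion (mid_measure \<mu> \<nu>))" if K: "compact K" for K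
  proof -
    have b: "- A \<inter> K \<in> sets borel" using A compact_borel[OF K] by auto
    have "- A \<inter> K \<in> null_sets (completion \<mu>)" "- A \<inter> K \<in> null_sets (completion \<nu>)"
      using m K by (auto simp: Mplus_def locally_negligible_def)
    then have "- A \<inter> K \<in> null_sets (mid_measure \<mu> \<nu>)"
      using b s by (simp add: null_sets_completion_iff null_sets_mid_measure)
    then show ?thesis by (rule null_sets_completionI)
  qed
  with radon_mid_measure[OF r] show ?thesis by (simp add: Mplus_def locally_negligible_def)
qed

lemma measure_le_mid_measure:
  fixes \<mu> \<nu> :: "'a::t2_space measure"
  assumes "sets \<nu> = sets \<mu>" "measure_le \<mu> \<xi>" "measure_le \<nu> \<xi>"
  shows "measure_le (mid_measure \<mu> \<nu>) \<xi>"
  unfolding measure_le_def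
proof
  fix B :: "'a set" assume B: "B \<in> sets borel"
  have "emeasure (mid_measure \<mu> \<nu>) B \<le> ennreal (1/2) * (emeasure \<xi> B + emeasure \<xi> B)"
    unfolding emeasure_mid_measure[OF assms(1)]
    using assms(2,3) B by (intro mult_left_mono add_mono) (auto simp: measure_le_def)
  also have "\<dots> = emeasure \<xi> B" by (simp add: distrib_left ennreal_half_plus_half del: ennreal_half)
  finally show "emeasure (mid_measure \<mu> \<nu>) B \<le> emeasure \<xi> B" .
qed

section \<open>The parallelogram identity for vector measures\<close>

text \<open>Positive definiteness speaks only about squares \<open>F \<times> F\<close>. These are
  cofinal among the finite subsets of \<open>I \<times> I\<close>, as \<open>F\<close> may collect
  all coordinates of a given finite set, so they detect the sign of the limit.\<close>

lemma infsum_nonneg_if_square_sums_nonneg: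
  fixes d :: "'i \<times> 'i \<Rightarrow> real"
  assumes d: "d summable_on I \<times> I"
    and sq: "\<And>F. finite F \<Longrightarrow> F \<subseteq> I \<Longrightarrow> 0 \<le> (\<Sum>p\<in>F \<times> F. d p)"
  shows "0 \<le> infsum d (I \<times> I)"
proof (rule ccontr)
  assume "\<not> 0 \<le> infsum d (I \<times> I)"
  moreover have "(sum d \<longlongrightarrow> infsum d (I \<times> I)) (finite_subsets_at_top (I \<times> I))"
    using has_sum_infsum[OF d] by (simp add: has_sum_def)
  ultimately have "\<forall>\<^sub>F G in finite_subsets_at_top (I \<times> I). sum d G < 0"
    by (intro order_tendstoD(2)) auto
  then obtain G where "finite G \<and> G \<subseteq> I \<times> I \<and>
      (\<forall>H. finite H \<and> G \<subseteq> H \<and> H \<subseteq> I \<times> I \<longrightarrow> sum d H < 0)"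
    unfolding eventually_finite_subsets_at_top by (rule exE)
  then have G: "finite G" "G \<subseteq> I \<times> I"
    "\<And>H. finite H \<Longrightarrow> G \<subseteq> H \<Longrightarrow> H \<subseteq> I \<times> I \<Longrightarrow> sum d H < 0"
    by simp_all
  define F where "F = fst ` G \<union> snd ` G"
  have F: "finite F" "F \<subseteq> I" using G(1,2) by (auto simp: F_def)
  have "G \<subseteq> F \<times> F" by (force simp: F_def)
  then have "sum d (F \<times> F) < 0" using F by (intro G(3)) auto
  with sq[OF F] show False by simp
qed

text \<open>By cofinality again: nonnegative terms make the sum over any finite set at most that
  over an enclosing square.\<close>

lemma summable_on_if_square_sums_bounded:
  fixes d :: "'i \<times> 'i \<Rightarrow> real"
  assumes nn: "\<And>p. p \<in> I \<times> I \<Longrightarrow> 0 \<le> d p"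
    and sq: "\<And>F. finite F \<Longrightarrow> F \<subseteq> I \<Longrightarrow> (\<Sum>p\<in>F \<times> F. d p) \<le> C"
  shows "d summable_on I \<times> I"
proof (rule nonneg_bdd_above_summable_on[OF nn], assumption)
  show "bdd_above (sum d ` {F. F \<subseteq> I \<times> I \<and> finite F})"
  proof (rule bdd_aboveI2)
    fix G assume "G \<in> {F. F \<subseteq> I \<times> I \<and> finite F}"
    then have G: "finite G" "G \<subseteq> I \<times> I" by auto
    define F where "F = fst ` G \<union> snd ` G"
    have F: "finite F" "F \<subseteq> I" using G by (auto simp: F_def)
    have "sum d G \<le> sum d (F \<times> F)"
    proof (rule sum_mono2)
      show "finite (F \<times> F)" using F by simp
      show "G \<subseteq> F \<times> F" by (force simp: F_def)
      show "0 \<le> d p" if "p \<in> F \<times> F - G" for p using that F(2) by (intro nn) auto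
    qed
    also have "\<dots> \<le> C" using sq[OF F] .
    finally show "sum d G \<le> C" .
  qed
qed

lemma plate_sign_cases: "plate_sign Ipos i = 1 \<or> plate_sign Ipos i = - 1"
  by (simp add: plate_sign_def)

lemma summable_on_abs_iff: "(\<lambda>j. \<bar>c j\<bar>) summable_on J \<longleftrightarrow> c summable_on J" for c :: "'j \<Rightarrow> real"
  using summable_on_iff_abs_summable_on_real[of c J] by simp

lemma series_finite_iff_summable_on:
  assumes "\<And>j. j \<in> J \<Longrightarrow> b j = ereal (c j)"
  shows "series_finite b J \<longleftrightarrow> c summable_on J"
proof -
  have "(\<lambda>j. \<bar>real_of_ereal (b j)\<bar>) summable_on J \<longleftrightarrow> (\<lambda>j. \<bar>c j\<bar>) summable_on J"
    using assms by (intro summable_on_cong) simp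
  then show ?thesis using assms by (simp add: series_finite_def summable_on_abs_iff)
qed

lemma series_sum_ereal: "(\<And>j. j \<in> J \<Longrightarrow> b j = ereal (c j)) \<Longrightarrow> series_sum b J = infsum c J"
  unfolding series_sum_def by (intro infsum_cong) simp

context energy_kernel
begin

text \<open>For the midpoints \<open>m\<close>, \<open>m'\<close> the energy of \<open>m + m\<close>
  and \<open>m' + m'\<close> is \<open>4 * e m m'\<close>, and these sums are
  \<open>\<mu> + \<nu>\<close> and \<open>\<mu>' + \<nu>'\<close>.\<close>

lemma
  assumes r: "radon \<mu>" "radon \<nu>" "radon \<mu>'" "radon \<nu>'"
    and f: "fin \<mu> \<mu>'" "fin \<mu> \<nu>'" "fin \<nu> \<mu>'" "fin \<nu> \<nu>'"
  shows fin_mid_measure: "fin (mid_measure \<mu> \<nu>) (mid_measure \<mu>' \<nu>')"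
    and e_mid_measure: "4 * e (mid_measure \<mu> \<nu>) (mid_measure \<mu>' \<nu>') = e \<mu> \<mu>' + e \<mu> \<nu>' + e \<nu> \<mu>' + e \<nu> \<nu>'"
proof -
  define m m' where m: "m = mid_measure \<mu> \<nu>" "m' = mid_measure \<mu>' \<nu>'"
  have rm: "radon m" "radon m'" using r by (simp_all add: m radon_mid_measure)
  have am: "add_measure m m = add_measure \<mu> \<nu>" "add_measure m' m' = add_measure \<mu>' \<nu>'"
    using r by (simp_all add: m add_measure_mid_measure radon_sets)
  have "fin (add_measure m m) (add_measure m' m')"
    unfolding am using r f by (simp add: fin_add_left fin_add_right radon_add_measure)
  then show fm: "fin (mid_measure \<mu> \<nu>) (mid_measure \<mu>' \<nu>')"
    using rm by (simp add: fin_add_left fin_add_right radon_add_measure m)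
  then have "e (add_measure m m) (add_measure m' m') = 4 * e m m'"
    using rm by (simp add: e_add_left e_add_right fin_add_right radon_add_measure m)
  moreover have "e (add_measure \<mu> \<nu>) (add_measure \<mu>' \<nu>') = e \<mu> \<mu>' + e \<mu> \<nu>' + e \<nu> \<mu>' + e \<nu> \<nu>'"
    using r f by (simp add: e_add_left e_add_right fin_add_right radon_add_measure)
  ultimately show "4 * e (mid_measure \<mu> \<nu>) (mid_measure \<mu>' \<nu>') = e \<mu> \<mu>' + e \<mu> \<nu>' + e \<nu> \<mu>' + e \<nu> \<nu>'"
    unfolding m[symmetric] am by simp
qed

lemma energy_terms_eq:
  "fin (\<mu> i) (\<mu> j) \<Longrightarrow> energy_terms \<kappa> Ipos \<mu> (i, j) = ereal (plate_sign Ipos i * plate_sign Ipos j * e (\<mu> i) (\<mu> j))"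
  by (simp add: energy_terms_def fin_E)

lemma fin_if_series_finite:
  assumes "series_finite (energy_terms \<kappa> Ipos \<mu>) (I \<times> I)" "i \<in> I" "j \<in> I"
  shows "fin (\<mu> i) (\<mu> j)"
proof -
  have "\<bar>energy_terms \<kappa> Ipos \<mu> (i, j)\<bar> \<noteq> \<infinity>"
    using assms by (simp add: series_finite_def)
  then show ?thesis
    using plate_sign_cases[of Ipos i] plate_sign_cases[of Ipos j]
    by (cases "E (\<mu> i) (\<mu> j)") (auto simp: energy_terms_def fin_def)
qed

lemma summable_energy_terms:
  assumes "series_finite (energy_terms \<kappa> Ipos \<mu>) (I \<times> I)"
  shows "(\<lambda>(i, j). plate_sign Ipos i * plate_sign Ipos j * e (\<mu> i) (\<mu> j)) summable_on I \<times> I"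
  using assms fin_if_series_finite[OF assms]
  by (subst series_finite_iff_summable_on[symmetric]) (auto simp: energy_terms_eq)

text \<open>Summability of a real family is absolute, so the plate signs may be dropped and
  convergence studied for the bare energies.\<close>

lemma summable_signed_iff:
  "(\<lambda>(i, j). plate_sign Ipos i * plate_sign Ipos j * h i j) summable_on J \<longleftrightarrow> (\<lambda>(i, j). h i j) summable_on J" for h :: "'i \<Rightarrow> 'i \<Rightarrow> real"
proof -
  have "\<bar>case p of (i, j) \<Rightarrow> plate_sign Ipos i * plate_sign Ipos j * h i j\<bar> = \<bar>case p of (i, j) \<Rightarrow> h i j\<bar>" for p
    by (cases p) (auto simp: plate_sign_def)
  then show ?thesis
    using summable_on_abs_iff[of "\<lambda>(i, j). plate_sign Ipos i * plate_sign Ipos j * h i j" J]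
      summable_on_abs_iff[of "\<lambda>(i, j). h i j" J] by simp
qed

text \<open>Convergence of the distance series is part of the claim, since
  \<open>energy_distance\<close> is \<open>\<infinity>\<close> otherwise. Its value then comes from
  an identity valid term by term; sigma-finiteness of the components is what allows each
  \<open>radon_diff\<close> to be expanded.\<close>

lemma parallelogram:
  fixes u v :: "'i \<Rightarrow> 'a measure"
  assumes cond: "generalized_condenser Ipos Ineg A"
    and u: "u \<in> finite_energy_vectors \<kappa> Ipos Ineg A" and v: "v \<in> finite_energy_vectors \<kappa> Ipos Ineg A"
    and su: "\<And>i. i \<in> Ipos \<union> Ineg \<Longrightarrow> sigma_radon (u i)" and sv: "\<And>i. i \<in> Ipos \<union> Ineg \<Longrightarrow> sigma_radon (v i)"
  defines "J \<equiv> (Ipos \<union> Ineg) \<times> (Ipos \<union> Ineg)" and "m \<equiv> \<lambda>i. mid_measure (u i) (v i)"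
  shows "series_finite (energy_terms \<kappa> Ipos m) J"
    and "series_finite (distance_terms \<kappa> Ipos u v) J"
    and "0 \<le> series_sum (distance_terms \<kappa> Ipos u v) J"
    and "series_sum (distance_terms \<kappa> Ipos u v) J =
      2 * vector_energy \<kappa> Ipos Ineg u + 2 * vector_energy \<kappa> Ipos Ineg v - 4 * vector_energy \<kappa> Ipos Ineg m"
proof -
  let ?I = "Ipos \<union> Ineg"
  let ?s = "\<lambda>i j. plate_sign Ipos i * plate_sign Ipos j"
  have ru: "radon (u i)" "radon (v i)" if "i \<in> ?I" for i using su sv that by (auto simp: sigma_radon_def)
  have U: "series_finite (energy_terms \<kappa> Ipos u) J" and V: "series_finite (energy_terms \<kappa> Ipos v) J"
    using u v by (auto simp: finite_energy_vectors_def J_def)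
  have fu: "fin (u i) (u j)" and fv: "fin (v i) (v j)" if "i \<in> ?I" "j \<in> ?I" for i j
    using fin_if_series_finite[OF U[unfolded J_def] that] fin_if_series_finite[OF V[unfolded J_def] that] .
  have fuv: "fin (u i) (v j)" and fvu: "fin (v i) (u j)" if "i \<in> ?I" "j \<in> ?I" for i j
    using cross_energy(1)[OF su sv fu fv] cross_energy(1)[OF sv su fv fu] that by blast+
  have sumU: "(\<lambda>(i, j). e (u i) (u j)) summable_on J" and sumV: "(\<lambda>(i, j). e (v i) (v j)) summable_on J"
    using summable_energy_terms[OF U[unfolded J_def]] summable_energy_terms[OF V[unfolded J_def]]
    by (simp_all add: summable_signed_iff J_def)
  have cross: "(\<lambda>(i, j). e (u i) (v j)) summable_on J \<and> (\<lambda>(i, j). e (v i) (u j)) summable_on J"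
  proof (cases "compact (UNIV :: 'a set)")
    case True
    \<comment> \<open>The whole space is now a compact set that meets every plate, because plates
      are nonempty.\<close>
    have "finite {i \<in> ?I. UNIV \<inter> A i \<noteq> {}}" using cond True unfolding generalized_condenser_def by blast
    moreover have "{i \<in> ?I. UNIV \<inter> A i \<noteq> {}} = ?I" using cond unfolding generalized_condenser_def by auto
    ultimately have "finite J" by (simp add: J_def)
    then show ?thesis by simp
  next
    case False
    have nn: "0 \<le> e \<mu> \<nu>" for \<mu> \<nu> using E_nonneg[OF False] by (simp add: e_def real_of_ereal_pos)
    define C where "C = infsum (\<lambda>(i, j). e (u i) (u j)) J + infsum (\<lambda>(i, j). e (v i) (v j)) J"
    have le: "(\<Sum>p\<in>F \<times> F. case p of (i, j) \<Rightarrow> e (u i) (v j)) + (\<Sum>p\<in>F \<times> F. case p of (i, j) \<Rightarrow> e (v i) (u j)) \<le> C"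
      if F: "finite F" "F \<subseteq> ?I" for F
    proof -
      have "(\<Sum>p\<in>F \<times> F. case p of (i, j) \<Rightarrow> e (u i) (v j)) + (\<Sum>p\<in>F \<times> F. case p of (i, j) \<Rightarrow> e (v i) (u j))
          \<le> (\<Sum>p\<in>F \<times> F. case p of (i, j) \<Rightarrow> e (u i) (u j)) + (\<Sum>p\<in>F \<times> F. case p of (i, j) \<Rightarrow> e (v i) (v j))"
        using double_sum_cross_energy[of F u v] F su sv fu fv
        by (simp add: sum.cartesian_product[symmetric] subset_iff)
      also have "\<dots> \<le> C"
        unfolding C_def using F nn
        by (intro add_mono finite_sum_le_infsum sumU sumV) (auto simp: J_def)
      finally show ?thesis .
    qed
    have pos: "0 \<le> (\<Sum>p\<in>F \<times> F. case p of (i, j) \<Rightarrow> e (u i) (v j))"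
        "0 \<le> (\<Sum>p\<in>F \<times> F. case p of (i, j) \<Rightarrow> e (v i) (u j))" for F
      using nn by (auto intro!: sum_nonneg)
    have b: "(\<Sum>p\<in>F \<times> F. case p of (i, j) \<Rightarrow> e (u i) (v j)) \<le> C"
      if "finite F" "F \<subseteq> ?I" for F
      using le[OF that] pos(2)[of F] by linarith
    have b': "(\<Sum>p\<in>F \<times> F. case p of (i, j) \<Rightarrow> e (v i) (u j)) \<le> C"
      if "finite F" "F \<subseteq> ?I" for F
      using le[OF that] pos(1)[of F] by linarith
    show ?thesis
      unfolding J_def using nn
      by (intro conjI summable_on_if_square_sums_bounded[where C = C] b b') auto
  qed
  have uu: "(\<lambda>(i, j). ?s i j * e (u i) (u j)) summable_on J"
    and vv: "(\<lambda>(i, j). ?s i j * e (v i) (v j)) summable_on J"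
    and uv: "(\<lambda>(i, j). ?s i j * e (u i) (v j)) summable_on J"
    and vu: "(\<lambda>(i, j). ?s i j * e (v i) (u j)) summable_on J"
    using sumU sumV cross by (simp_all add: summable_signed_iff)
  have fm: "fin (m i) (m j)" and em: "e (m i) (m j) = (e (u i) (u j) + e (u i) (v j) + e (v i) (u j) + e (v i) (v j)) / 4"
    if "i \<in> ?I" "j \<in> ?I" for i j
    using fin_mid_measure[of "u i" "v i" "u j" "v j"] e_mid_measure[of "u i" "v i" "u j" "v j"] ru fu fv fuv fvu that
    by (simp_all add: m_def)
  define d where "d = (\<lambda>(i, j). ?s i j * (e (u i) (u j) + e (v i) (v j) - e (u i) (v j) - e (v i) (u j)))"
  have dist: "distance_terms \<kappa> Ipos u v p = ereal (d p)" if "p \<in> J" for p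
    using that su sv fu fv fuv fvu
    by (auto simp: distance_terms_def d_def J_def signed_mutual_energy_radon_diff)
  have mt: "energy_terms \<kappa> Ipos m p = ereal (case p of (i, j) \<Rightarrow> ?s i j * e (m i) (m j))" if "p \<in> J" for p
    using that by (auto simp: J_def energy_terms_eq fm)
  have mm: "(\<lambda>(i, j). ?s i j * e (m i) (m j)) summable_on J"
  proof -
    have "(\<lambda>p. (1/4) * ((case p of (i, j) \<Rightarrow> ?s i j * e (u i) (u j)) + (case p of (i, j) \<Rightarrow> ?s i j * e (u i) (v j))
        + (case p of (i, j) \<Rightarrow> ?s i j * e (v i) (u j)) + (case p of (i, j) \<Rightarrow> ?s i j * e (v i) (v j)))) summable_on J"
      by (intro summable_on_cmult_right summable_on_add uu uv vu vv)
    then show ?thesis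
      by (rule summable_on_cong[THEN iffD1, rotated]) (auto simp: J_def em algebra_simps add_divide_distrib)
  qed
  then show "series_finite (energy_terms \<kappa> Ipos m) J"
    by (subst series_finite_iff_summable_on) (erule mt)
  have deq: "d p = 2 * (case p of (i, j) \<Rightarrow> ?s i j * e (u i) (u j)) + 2 * (case p of (i, j) \<Rightarrow> ?s i j * e (v i) (v j))
      + (-4) * (case p of (i, j) \<Rightarrow> ?s i j * e (m i) (m j))" if "p \<in> J" for p
    using that by (auto simp: d_def J_def em algebra_simps)
  have sr: "(\<lambda>p. 2 * (case p of (i, j) \<Rightarrow> ?s i j * e (u i) (u j)) + 2 * (case p of (i, j) \<Rightarrow> ?s i j * e (v i) (v j))
      + (-4) * (case p of (i, j) \<Rightarrow> ?s i j * e (m i) (m j))) summable_on J"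
    by (intro summable_on_add summable_on_cmult_right uu vv mm)
  then have ds: "d summable_on J" by (rule summable_on_cong[THEN iffD1, rotated]) (simp add: deq)
  then show "series_finite (distance_terms \<kappa> Ipos u v) J"
    by (subst series_finite_iff_summable_on) (erule dist)
  have V_eq: "vector_energy \<kappa> Ipos Ineg w = infsum (\<lambda>(i, j). ?s i j * e (w i) (w j)) J"
    if "\<And>i j. i \<in> ?I \<Longrightarrow> j \<in> ?I \<Longrightarrow> fin (w i) (w j)" for w
    unfolding vector_energy_def J_def[symmetric]
    using that by (intro series_sum_ereal) (auto simp: J_def energy_terms_eq)
  have sd: "series_sum (distance_terms \<kappa> Ipos u v) J = infsum d J"
    by (rule series_sum_ereal) (erule dist)
  have "infsum d J = 2 * infsum (\<lambda>(i, j). ?s i j * e (u i) (u j)) J + 2 * infsum (\<lambda>(i, j). ?s i j * e (v i) (v j)) J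
      + (-4) * infsum (\<lambda>(i, j). ?s i j * e (m i) (m j)) J"
    by (subst infsum_cong[OF deq], assumption)
       (simp only: infsum_add infsum_cmult_right' summable_on_add summable_on_cmult_right uu vv mm)
  then show "series_sum (distance_terms \<kappa> Ipos u v) J =
      2 * vector_energy \<kappa> Ipos Ineg u + 2 * vector_energy \<kappa> Ipos Ineg v - 4 * vector_energy \<kappa> Ipos Ineg m"
    unfolding sd using V_eq[of u] V_eq[of v] V_eq[of m] fu fv fm by simp
  show "0 \<le> series_sum (distance_terms \<kappa> Ipos u v) J"
    unfolding sd unfolding J_def
  proof (rule infsum_nonneg_if_square_sums_nonneg)
    show "d summable_on ?I \<times> ?I" using ds by (simp add: J_def)
    fix F assume F: "finite F" "F \<subseteq> ?I"
    \<comment> \<open>Exchanging the two vectors on the negative plates absorbs the signs: the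
      signed difference of \<open>u i\<close> and \<open>v i\<close> is \<open>x i - y i\<close>, so
      the square sum is the energy of the sum of all \<open>x i\<close> minus the sum of all
      \<open>y i\<close>.\<close>
    define x y where "x i = (if i \<in> Ipos then u i else v i)" and "y i = (if i \<in> Ipos then v i else u i)" for i
    have "(\<Sum>p\<in>F \<times> F. d p) = (\<Sum>i\<in>F. \<Sum>j\<in>F. d (i, j))"
      by (simp add: sum.cartesian_product)
    also have "\<dots> = (\<Sum>i\<in>F. \<Sum>j\<in>F. e (x i) (x j) + e (y i) (y j) - e (x i) (y j) - e (y i) (x j))"
      by (intro sum.cong refl) (auto simp: d_def x_def y_def plate_sign_def)
    also have "\<dots> = (\<Sum>i\<in>F. \<Sum>j\<in>F. e (x i) (x j)) + (\<Sum>i\<in>F. \<Sum>j\<in>F. e (y i) (y j))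
        - ((\<Sum>i\<in>F. \<Sum>j\<in>F. e (x i) (y j)) + (\<Sum>i\<in>F. \<Sum>j\<in>F. e (y i) (x j)))"
      by (simp add: sum.distrib sum_subtractf)
    also have "0 \<le> \<dots>"
    proof -
      have "(\<Sum>i\<in>F. \<Sum>j\<in>F. e (x i) (y j)) + (\<Sum>i\<in>F. \<Sum>j\<in>F. e (y i) (x j))
          \<le> (\<Sum>i\<in>F. \<Sum>j\<in>F. e (x i) (x j)) + (\<Sum>i\<in>F. \<Sum>j\<in>F. e (y i) (y j))"
      proof (rule double_sum_cross_energy[OF F(1)])
        fix i j assume "i \<in> F" "j \<in> F"
        then have ij: "i \<in> ?I" "j \<in> ?I" using F(2) by auto
        show "sigma_radon (x i)" "sigma_radon (y i)"
          using su[OF ij(1)] sv[OF ij(1)] by (simp_all add: x_def y_def)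
        show "fin (x i) (x j)" "fin (y i) (y j)"
          using fu[OF ij] fv[OF ij] fuv[OF ij] fvu[OF ij] by (simp_all add: x_def y_def)
      qed
      then show ?thesis by simp
    qed
    finally show "0 \<le> (\<Sum>p\<in>F \<times> F. d p)" .
  qed
qed

end

theorem lemma4p4:
  fixes \<kappa> :: "'a::t2_space \<times> 'a \<Rightarrow> ereal"
    and Ipos Ineg I0 :: "'i set"
    and A :: "'i \<Rightarrow> 'a set"
    and a :: "'i \<Rightarrow> real"
    and g :: "'i \<Rightarrow> 'a \<Rightarrow> real"
    and f :: "'i \<Rightarrow> 'a \<Rightarrow> ereal"
    and \<xi> lam lam_hat :: "'i \<Rightarrow> 'a measure"
  assumes "locally_compact_space (euclidean :: 'a topology)"
    and "symmetric_lsc_kernel \<kappa>" and "positive_definite \<kappa>"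
    and "generalized_condenser Ipos Ineg A"
    and "\<And>i. i \<in> Ipos \<union> Ineg \<Longrightarrow> a i > 0"
    and "\<And>i. i \<in> Ipos \<union> Ineg \<Longrightarrow> continuous_on UNIV (g i)"
    and "\<And>i x. i \<in> Ipos \<union> Ineg \<Longrightarrow> g i x > 0"
    and "\<And>i \<mu>. i \<in> Ipos \<union> Ineg \<Longrightarrow> radon \<mu> \<Longrightarrow> radon_measurable \<mu> (f i)"
    and "I0 \<subseteq> Ipos \<union> Ineg"
    and "\<And>i. i \<in> I0 \<Longrightarrow> \<xi> i \<in> Mplus (A i)"
    and "\<And>i. i \<in> I0 \<Longrightarrow> pairing (\<lambda>x. ereal (g i x)) (\<xi> i) > ereal (a i)"
    and "admissible \<kappa> f Ipos Ineg A a g I0 \<xi> \<noteq> {}"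
    and "is_solution \<kappa> f Ipos Ineg A a g I0 \<xi> lam"
    and "is_solution \<kappa> f Ipos Ineg A a g I0 \<xi> lam_hat"
  shows "energy_distance \<kappa> Ipos Ineg lam lam_hat = 0"
proof -
  interpret energy_kernel \<kappa> using assms(1-3) by unfold_locales
  let ?I = "Ipos \<union> Ineg"
  let ?adm = "admissible \<kappa> f Ipos Ineg A a g I0 \<xi>"
  let ?G = "gauss_functional \<kappa> Ipos Ineg f"
  let ?d = "distance_terms \<kappa> Ipos lam lam_hat"
  have adm: "lam \<in> ?adm" "lam_hat \<in> ?adm" using assms(13,14) by (simp_all add: is_solution_def)
  have gm: "g i \<in> borel_measurable borel" if "i \<in> ?I" for i
    using assms(6)[OF that] by (rule borel_measurable_continuous_onI)
  have radon: "radon (\<mu> i)" if "\<mu> \<in> ?adm" "i \<in> ?I" for \<mu> i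
    using that by (auto simp: admissible_def finite_energy_vectors_def Mplus_def)
  have sr: "sigma_radon (\<mu> i)" if "\<mu> \<in> ?adm" "i \<in> ?I" for \<mu> i
  proof -
    have "pairing (\<lambda>x. ereal (g i x)) (\<mu> i) = ereal (a i)" using that by (auto simp: admissible_def)
    then have "\<bar>pairing (\<lambda>x. ereal (g i x)) (\<mu> i)\<bar> \<noteq> \<infinity>" by simp
    from sigma_finite_measure_if_pairing_finite[OF radon_sets[OF radon[OF that]] gm[OF that(2)] assms(7)[OF that(2)] this]
    show ?thesis using radon[OF that] by (simp add: sigma_radon_def)
  qed
  define m where "m i = mid_measure (lam i) (lam_hat i)" for i
  have fe: "lam \<in> finite_energy_vectors \<kappa> Ipos Ineg A" "lam_hat \<in> finite_energy_vectors \<kappa> Ipos Ineg A"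
    using adm by (auto simp: admissible_def)
  note par = parallelogram[OF assms(4) fe sr[OF adm(1)] sr[OF adm(2)], folded m_def]
  have sets_eq: "sets (lam_hat i) = sets (lam i)" if "i \<in> ?I" for i
    using radon[OF adm(1) that] radon[OF adm(2) that] by (simp add: radon_sets)
  have int: "radon_integrable (lam i) (f i)" "radon_integrable (lam_hat i) (f i)" if "i \<in> ?I" for i
    using adm that by (auto simp: admissible_def)
  have gint: "radon_integrable (\<mu> i) (\<lambda>x. ereal (g i x))" if "\<mu> \<in> ?adm" "i \<in> ?I" for \<mu> i
  proof -
    have "g i \<in> borel_measurable (\<mu> i)"
      using gm[OF that(2)] measurable_cong_sets[OF radon_sets[OF radon[OF that]] refl] by blast
    then have "(\<lambda>x. ereal (g i x)) \<in> borel_measurable (completion (\<mu> i))"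
      by (intro measurable_completion) simp
    moreover have "pairing (\<lambda>x. ereal (g i x)) (\<mu> i) = ereal (a i)" using that by (auto simp: admissible_def)
    ultimately show ?thesis by (simp add: radon_integrable_def)
  qed
  have ft: "field_terms f m i = ereal ((real_of_ereal (field_terms f lam i) + real_of_ereal (field_terms f lam_hat i)) / 2)"
    if "i \<in> ?I" for i
    unfolding field_terms_def m_def by (rule pairing_mid_measure[OF sets_eq int]) (fact that)+
  let ?\<phi> = "\<lambda>\<mu> i. real_of_ereal (field_terms f \<mu> i)"
  have \<phi>: "?\<phi> \<mu> summable_on ?I" if "\<mu> \<in> ?adm" for \<mu>
    using that summable_on_abs_iff[of "?\<phi> \<mu>" ?I] unfolding admissible_def series_finite_def by blast
  have \<phi>m: "(\<lambda>i. (1/2) * (?\<phi> lam i + ?\<phi> lam_hat i)) summable_on ?I"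
    by (intro summable_on_cmult_right summable_on_add \<phi> adm)
  have ft': "field_terms f m i = ereal ((1/2) * (?\<phi> lam i + ?\<phi> lam_hat i))" if "i \<in> ?I" for i
    using ft[OF that] by simp
  have "m \<in> ?adm"
    unfolding admissible_def finite_energy_vectors_def mem_Collect_eq
  proof (intro conjI ballI)
    fix i assume i: "i \<in> ?I"
    have "A i \<in> sets borel" using assms(4) i by (simp add: generalized_condenser_def)
    moreover have "lam i \<in> Mplus (A i)" "lam_hat i \<in> Mplus (A i)"
      using fe i by (auto simp: finite_energy_vectors_def)
    ultimately show "m i \<in> Mplus (A i)" unfolding m_def by (rule Mplus_mid_measure)
    show "pairing (\<lambda>x. ereal (g i x)) (m i) = ereal (a i)"
      unfolding m_def pairing_mid_measure[OF sets_eq[OF i] gint[OF adm(1) i] gint[OF adm(2) i]]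
      using adm i by (simp add: admissible_def)
    show "radon_integrable (m i) (f i)"
      unfolding m_def by (rule radon_integrable_mid_measure[OF sets_eq[OF i] int[OF i]])
  next
    fix i assume i: "i \<in> I0"
    have "measure_le (lam i) (\<xi> i)" "measure_le (lam_hat i) (\<xi> i)" using adm i by (auto simp: admissible_def)
    then show "measure_le (m i) (\<xi> i)"
      unfolding m_def using sets_eq[of i] i assms(9) by (intro measure_le_mid_measure) auto
  next
    show "series_finite (field_terms f m) ?I"
      using \<phi>m by (subst series_finite_iff_summable_on) (erule ft')
    show "series_finite (energy_terms \<kappa> Ipos m) (?I \<times> ?I)" by (rule par(1))
  qed
  \<comment> \<open>Each solution attains the infimum over a class that contains the
    midpoint.\<close>
  then have "?G lam \<le> ?G m" "?G lam_hat \<le> ?G m"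
    using assms(13,14) unfolding is_solution_def by (metis INF_lower ereal_less_eq(3))+
  then have G: "2 * ?G lam + 2 * ?G lam_hat \<le> 4 * ?G m" by simp
  have "series_sum (field_terms f m) ?I = (\<Sum>\<^sub>\<infinity>i\<in>?I. (1/2) * (?\<phi> lam i + ?\<phi> lam_hat i))"
    by (rule series_sum_ereal) (erule ft')
  then have F: "2 * series_sum (field_terms f m) ?I = series_sum (field_terms f lam) ?I + series_sum (field_terms f lam_hat) ?I"
    unfolding series_sum_def infsum_cmult_right' infsum_add[OF \<phi>[OF adm(1)] \<phi>[OF adm(2)]] by simp
  have "series_sum ?d (?I \<times> ?I) = 2 * vector_energy \<kappa> Ipos Ineg lam
      + 2 * vector_energy \<kappa> Ipos Ineg lam_hat - 4 * vector_energy \<kappa> Ipos Ineg m"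
    by (rule par(4))
  \<comment> \<open>The field contributes \<open>4\<close> times each of the two field sums minus
    \<open>8\<close> times that of \<open>m\<close>; by \<open>F\<close> this is 0.\<close>
  also have "\<dots> = 2 * ?G lam + 2 * ?G lam_hat - 4 * ?G m"
    using F by (simp add: gauss_functional_def)
  also have "\<dots> \<le> 0" using G by simp
  finally have "series_sum ?d (?I \<times> ?I) \<le> 0" .
  with par(3) have "series_sum ?d (?I \<times> ?I) = 0" by simp
  \<comment> \<open>Convergence of the series excludes the default value \<open>\<infinity>\<close>
    of the distance.\<close>
  with par(2) show ?thesis by (simp add: energy_distance_def zero_ereal_def)
qed

end
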